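(* For every integer $r \ge 3$, there exist infinitely many families $\mathcal{F}$ of graphs with $|\mathcal{F}| = 3$ such that the ratio $\frac{\mathrm{sat}(n, K_r, \mathcal{F})}{n}$ does not tend to a limit as $n \to \infty$.
   Context: For a family of graphs $\mathcal{F}$, a graph $G$ is $\mathcal{F}$-saturated if $G$ contains no copy of any graph in $\mathcal{F}$, but adding any edge to $G$ creates a copy of some graph in $\mathcal{F}$. $\mathrm{sat}(n, K_r, \mathcal{F})$ is the minimum number of copies of the complete graph $K_r$ in an $n$-vertex $\mathcal{F}$-saturated graph. *)

theory Defs
  imports Complex_Main
begin

text \<open>A graph is a pair of a vertex set and a set of two-element vertex sets. All graphs are
  finite, so up to isomorphism nothing is lost by drawing vertices from \<^typ>\<open>nat\<close>.\<close>

type_synonym graph = "nat set \<times> nat set set"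

abbreviation verts :: "graph \<Rightarrow> nat set" where
  "verts G \<equiv> fst G"

abbreviation edges :: "graph \<Rightarrow> nat set set" where
  "edges G \<equiv> snd G"

definition simple_graph :: "graph \<Rightarrow> bool" where
  "simple_graph G \<longleftrightarrow> finite (verts G) \<and> (\<forall>e \<in> edges G. e \<subseteq> verts G \<and> card e = 2)"

definition subgraph :: "graph \<Rightarrow> graph \<Rightarrow> bool" where
  "subgraph H G \<longleftrightarrow> simple_graph H \<and> verts H \<subseteq> verts G \<and> edges H \<subseteq> edges G"

definition graph_iso :: "graph \<Rightarrow> graph \<Rightarrow> bool" where
  "graph_iso G H \<longleftrightarrow>
     (\<exists>f. bij_betw f (verts G) (verts H) \<and> edges H = (\<lambda>e. f ` e) ` edges G)"

definition copies :: "graph \<Rightarrow> graph \<Rightarrow> graph set" where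
  "copies H G = {S. subgraph S G \<and> graph_iso H S}"

definition complete_graph :: "nat \<Rightarrow> graph" where
  "complete_graph r = ({..<r}, {e. e \<subseteq> {..<r} \<and> card e = 2})"

definition add_edge :: "graph \<Rightarrow> nat \<Rightarrow> nat \<Rightarrow> graph" where
  "add_edge G u v = (verts G, insert {u, v} (edges G))"

definition saturated :: "graph set \<Rightarrow> graph \<Rightarrow> bool" where
  "saturated \<F> G \<longleftrightarrow>
     (\<forall>H \<in> \<F>. copies H G = {}) \<and>
     (\<forall>u \<in> verts G. \<forall>v \<in> verts G. u \<noteq> v \<and> {u, v} \<notin> edges G \<longrightarrow>
        (\<exists>H \<in> \<F>. copies H (add_edge G u v) \<noteq> {}))"

text \<open>The minimum exists for every \<open>n\<close> as soon as every member of the family has an edge (take an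
  edge-maximal graph without copies of members). If some member is edgeless, no saturated graph
  exists for large \<open>n\<close>; since \<^term>\<open>Inf {} = (0::nat)\<close>, the values are then eventually \<open>0\<close>, so
  such a family is never one for which the ratio to \<open>n\<close> fails to converge.\<close>

definition sat :: "nat \<Rightarrow> graph \<Rightarrow> graph set \<Rightarrow> nat" where
  "sat n H \<F> =
     Inf {card (copies H G) | G. simple_graph G \<and> card (verts G) = n \<and> saturated \<F> G}"

text \<open>Graphs in a family are identified up to isomorphism: the members of a family are pairwise
  non-isomorphic, and two families are the same if their members represent the same isomorphism
  classes.\<close>

definition iso_class :: "graph \<Rightarrow> graph set" where
  "iso_class G = {H. simple_graph H \<and> graph_iso G H}"

definition graph_family :: "graph set \<Rightarrow> bool" where
  "graph_family \<F> \<longleftrightarrow> (\<forall>G \<in> \<F>. simple_graph G) \<and> inj_on iso_class \<F>"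

definition family_class :: "graph set \<Rightarrow> graph set set" where
  "family_class \<F> = iso_class ` \<F>"

end

theory Submission imports Defs
begin

text \<open>For large \<open>m\<close> forbid the following: two disjoint copies of \<open>K\<^sub>m\<close> joined by an edge; a \<open>K\<^sub>m\<close> with
  a further vertex adjacent to \<open>r\<close> of its vertices; a \<open>K\<^sub>m\<close> and a \<open>K\<^bsub>m-r+2\<^esub>\<close> sharing exactly one vertex.

  If \<open>m\<close> divides \<open>n\<close>, disjoint copies of \<open>K\<^sub>m\<close> form a saturated graph in which every vertex lies in
  exactly \<open>\<tau> = (m-1 choose r-1)\<close> copies of \<open>K\<^sub>r\<close>. In any saturated graph the copies of \<open>K\<^sub>m\<close> are pairwise
  disjoint and have no edges between them, so if \<open>m\<close> does not divide \<open>n\<close>, some vertex \<open>u\<close> lies in no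
  \<open>K\<^sub>m\<close>. Saturation at the pairs \<open>uq\<close> with \<open>q\<close> in a copy \<open>Q\<close> of \<open>K\<^sub>m\<close> then forces a \<open>K\<^sub>r\<close> that meets both
  \<open>Q\<close> and its complement; hence every copy of \<open>K\<^sub>m\<close> carries more than \<open>m\<tau>\<close> incidences with copies of \<open>K\<^sub>r\<close>.

  It remains to see that the set \<open>R\<close> of vertices outside all \<open>K\<^sub>m\<close> is not cheaper. Two non-adjacent
  vertices of \<open>R\<close> have a \<open>K\<^bsub>m-r\<^esub>\<close> in their common neighbourhood. If \<open>v \<in> R\<close> lies in boundedly many \<open>K\<^sub>r\<close>,
  these common cliques lie in a bounded set, so every non-neighbour of \<open>v\<close> in \<open>R\<close> contributes about \<open>\<tau>\<close>
  copies of \<open>K\<^sub>r\<close> of its own, each with \<open>r\<close> incidences; this is enough as soon as \<open>v\<close> has slightly more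
  than \<open>|R|/r\<close> non-neighbours. If almost all vertices of \<open>R\<close> lie in boundedly many \<open>K\<^sub>r\<close> and all of them
  have fewer non-neighbours, \<open>v\<close> can be completed greedily to new copies of \<open>K\<^sub>r\<close>, a contradiction. So the
  ratio is bounded away from its value for multiples of \<open>m\<close>.\<close>

section \<open>Cliques and embeddings\<close>

definition pairs :: "nat set \<Rightarrow> nat set set" where
  "pairs A = {e. e \<subseteq> A \<and> card e = 2}"

definition clique :: "graph \<Rightarrow> nat set \<Rightarrow> bool" where
  "clique G S \<longleftrightarrow> S \<subseteq> verts G \<and> pairs S \<subseteq> edges G"

lemma pairs_iff: "e \<in> pairs A \<longleftrightarrow> (\<exists>x\<in>A. \<exists>y\<in>A. x \<noteq> y \<and> e = {x, y})"
  by (auto simp: pairs_def card_2_iff)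

lemma doubleton_in_pairs: "x \<in> A \<Longrightarrow> y \<in> A \<Longrightarrow> x \<noteq> y \<Longrightarrow> {x, y} \<in> pairs A"
  by (auto simp: pairs_def)

lemma pairs_doubleton: "x \<noteq> y \<Longrightarrow> pairs {x, y} = {{x, y}}"
  by (auto simp: pairs_def card_2_iff)

lemma clique_iff:
  "clique G S \<longleftrightarrow> S \<subseteq> verts G \<and> (\<forall>x\<in>S. \<forall>y\<in>S. x \<noteq> y \<longrightarrow> {x, y} \<in> edges G)"
  unfolding clique_def by (auto simp: pairs_iff subset_iff)

lemma clique_subset: "clique G S \<Longrightarrow> S' \<subseteq> S \<Longrightarrow> clique G S'"
  unfolding clique_iff by blast

lemma clique_edge: "clique G S \<Longrightarrow> x \<in> S \<Longrightarrow> y \<in> S \<Longrightarrow> x \<noteq> y \<Longrightarrow> {x, y} \<in> edges G"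
  unfolding clique_iff by blast

lemma clique_insert:
  assumes "clique G S" "x \<in> verts G" "\<And>y. y \<in> S \<Longrightarrow> y \<noteq> x \<Longrightarrow> {x, y} \<in> edges G"
  shows "clique G (insert x S)"
  using assms unfolding clique_iff by (auto simp: insert_commute)

definition embeds :: "(nat \<Rightarrow> nat) \<Rightarrow> graph \<Rightarrow> graph \<Rightarrow> bool" where
  "embeds f H G \<longleftrightarrow> inj_on f (verts H) \<and> f ` verts H \<subseteq> verts G \<and> (\<forall>e \<in> edges H. f ` e \<in> edges G)"

text \<open>The image of an injective edge-preserving map is itself a copy, so forbidding copies
  means forbidding embeddings; these need not be induced.\<close>

lemma copies_nonempty_iff:
  assumes "simple_graph H"
  shows "copies H G \<noteq> {} \<longleftrightarrow> (\<exists>f. embeds f H G)"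
proof
  assume "copies H G \<noteq> {}"
  then obtain S f where S: "subgraph S G" "bij_betw f (verts H) (verts S)"
      "edges S = (\<lambda>e. f ` e) ` edges H"
    by (auto simp: copies_def graph_iso_def)
  then show "\<exists>f. embeds f H G"
    by (intro exI[of _ f]) (auto simp: embeds_def subgraph_def bij_betw_def)
next
  assume "\<exists>f. embeds f H G"
  then obtain f where f: "inj_on f (verts H)" "f ` verts H \<subseteq> verts G" "\<forall>e \<in> edges H. f ` e \<in> edges G"
    by (auto simp: embeds_def)
  define S where "S = (f ` verts H, (\<lambda>e. f ` e) ` edges H)"
  have "card (f ` e) = 2" if "e \<in> edges H" for e
    using assms that f(1) by (metis card_image inj_on_subset simple_graph_def)
  then have "simple_graph S"
    using assms by (auto simp: S_def simple_graph_def)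
  then have "S \<in> copies H G"
    using f unfolding copies_def subgraph_def graph_iso_def
    by (auto simp: S_def bij_betw_def)
  then show "copies H G \<noteq> {}" by blast
qed

lemma clique_image_iff:
  assumes "inj_on f A" "f ` A \<subseteq> verts G"
  shows "clique G (f ` A) \<longleftrightarrow> (\<forall>e \<in> pairs A. f ` e \<in> edges G)"
proof
  assume c: "clique G (f ` A)"
  show "\<forall>e\<in>pairs A. f ` e \<in> edges G"
  proof
    fix e assume "e \<in> pairs A"
    then obtain x y where xy: "x \<in> A" "y \<in> A" "x \<noteq> y" "e = {x, y}"
      by (auto simp: pairs_iff)
    then have "f x \<noteq> f y" using assms(1) by (auto dest: inj_onD)
    then show "f ` e \<in> edges G" using xy clique_edge[OF c] by auto
  qed
next
  assume e: "\<forall>e\<in>pairs A. f ` e \<in> edges G"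
  have "{f x, f y} \<in> edges G" if "x \<in> A" "y \<in> A" "x \<noteq> y" for x y
    using bspec[OF e doubleton_in_pairs[OF that]] by simp
  then show "clique G (f ` A)"
    using assms unfolding clique_iff by auto
qed

text \<open>A copy of a complete graph is determined by its vertex set, since its edges must be all
  pairs of it. This lets \<open>K_r\<close> be counted through vertex sets alone.\<close>

lemma card_copies_complete_graph:
  assumes "simple_graph G"
  shows "card (copies (complete_graph r) G) = card {S. clique G S \<and> card S = r}"
proof -
  have *: "copies (complete_graph r) G = (\<lambda>S. (S, pairs S)) ` {S. clique G S \<and> card S = r}"
  proof (intro equalityI subsetI)
    fix S assume "S \<in> copies (complete_graph r) G"
    then obtain f where f: "subgraph S G" "bij_betw f {..<r} (verts S)"
       "edges S = (\<lambda>e. f ` e) ` pairs {..<r}"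
      by (auto simp: copies_def graph_iso_def complete_graph_def pairs_def)
    have inj: "inj_on f {..<r}" and im: "f ` {..<r} = verts S"
      using f(2) by (auto simp: bij_betw_def)
    have es: "edges S = pairs (verts S)"
    proof (intro equalityI subsetI)
      fix e assume "e \<in> edges S"
      then show "e \<in> pairs (verts S)"
        using f(1) by (auto simp: subgraph_def simple_graph_def pairs_def)
    next
      fix e assume "e \<in> pairs (verts S)"
      then obtain x y where xy: "x < r" "y < r" "f x \<noteq> f y" "e = {f x, f y}"
        unfolding pairs_iff im[symmetric] by auto
      then have "{x, y} \<in> pairs {..<r}" "e = f ` {x, y}"
        by (auto intro: doubleton_in_pairs)
      then show "e \<in> edges S" using f(3) by blast
    qed
    have "card (verts S) = r"
      using inj im by (metis card_image card_lessThan)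
    moreover have "clique G (verts S)"
      using f(1) es by (auto simp: clique_def subgraph_def)
    ultimately show "S \<in> (\<lambda>S. (S, pairs S)) ` {S. clique G S \<and> card S = r}"
      using es by (metis (mono_tags, lifting) image_eqI mem_Collect_eq prod.collapse)
  next
    fix S assume "S \<in> (\<lambda>S. (S, pairs S)) ` {S. clique G S \<and> card S = r}"
    then obtain C where C: "S = (C, pairs C)" "clique G C" "card C = r" by auto
    have fin: "finite C"
      using C(2) assms by (auto simp: clique_def simple_graph_def intro: finite_subset)
    then obtain f where f: "bij_betw f {..<r} C"
      using C(3) by (metis atLeast0LessThan ex_bij_betw_nat_finite)
    have inj: "inj_on f {..<r}" and im: "f ` {..<r} = C"
      using f by (auto simp: bij_betw_def)
    have "clique S (f ` {..<r})" unfolding im by (simp add: clique_def C(1))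
    then have "(\<lambda>e. f ` e) ` pairs {..<r} \<subseteq> pairs C"
      using clique_image_iff[OF inj, of S] im C(1) by auto
    moreover have "e \<in> (\<lambda>e. f ` e) ` pairs {..<r}" if "e \<in> pairs C" for e
    proof -
      from that obtain x y where xy: "x < r" "y < r" "f x \<noteq> f y" "e = {f x, f y}"
        unfolding pairs_iff im[symmetric] by auto
      then have "{x, y} \<in> pairs {..<r}" "e = f ` {x, y}"
        by (auto intro: doubleton_in_pairs)
      then show ?thesis by blast
    qed
    ultimately have "pairs C = (\<lambda>e. f ` e) ` pairs {..<r}" by blast
    then have "graph_iso (complete_graph r) S"
      using f unfolding graph_iso_def complete_graph_def C(1) pairs_def by auto
    moreover have "subgraph S G"
      using C fin by (auto simp: subgraph_def simple_graph_def clique_def pairs_def)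
    ultimately show "S \<in> copies (complete_graph r) G" by (simp add: copies_def)
  qed
  show ?thesis unfolding * by (intro card_image) (auto simp: inj_on_def)
qed

section \<open>The forbidden graphs\<close>

definition dumbbell :: "nat \<Rightarrow> graph" where
  "dumbbell m = ({..<2*m}, pairs {..<m} \<union> pairs {m..<2*m} \<union> pairs {0, m})"

text \<open>The apex \<open>m\<close> and its \<open>r\<close> neighbours are entered as a clique of
  their own, so that \<open>clique_image_iff\<close> treats both parts alike.\<close>

definition clique_apex :: "nat \<Rightarrow> nat \<Rightarrow> graph" where
  "clique_apex m r = ({..m}, pairs {..<m} \<union> pairs (insert m {..<r}))"

text \<open>For \<open>r \<le> m\<close> the interval starting at \<open>m\<close> has
  \<open>m - r + 1\<close> elements; with the shared vertex 0 it spans a clique on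
  \<open>m - r + 2\<close> vertices.\<close>

definition glued_cliques :: "nat \<Rightarrow> nat \<Rightarrow> graph" where
  "glued_cliques m r = ({..<2*m-r+1}, pairs {..<m} \<union> pairs (insert 0 {m..<2*m-r+1}))"

lemma simple_graph_forbidden:
  assumes "0 < m"
  shows "simple_graph (dumbbell m)"
    and "r \<le> m \<Longrightarrow> simple_graph (clique_apex m r)"
    and "r \<le> m \<Longrightarrow> simple_graph (glued_cliques m r)"
proof -
  have *: "simple_graph (B, E)" if "finite B" "E \<subseteq> pairs B" for B E
    using that by (auto simp: simple_graph_def pairs_def)
  have mono: "pairs A \<subseteq> pairs B" if "A \<subseteq> B" for A B using that by (auto simp: pairs_def)
  show "simple_graph (dumbbell m)"
    unfolding dumbbell_def using assms by (intro * Un_least mono) auto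
  show "simple_graph (clique_apex m r)" if "r \<le> m"
    unfolding clique_apex_def using that by (intro * Un_least mono) auto
  show "simple_graph (glued_cliques m r)" if "r \<le> m"
    unfolding glued_cliques_def using that assms by (intro * Un_least mono) auto
qed

lemma finite_clique: "simple_graph G \<Longrightarrow> clique G S \<Longrightarrow> finite S"
  by (auto simp: clique_def simple_graph_def intro: finite_subset)

text \<open>Lets an embedding place a distinguished vertex where it must go: an end of the bridge of
  a dumbbell, or the vertex shared by two glued cliques.\<close>

lemma bij_betw_with_value:
  assumes "finite A" "finite B" "card A = card B" "a \<in> A" "b \<in> B"
  obtains f where "bij_betw f A B" "f a = b"
proof -
  have "card (A - {a}) = card (B - {b})" using assms by simp
  then obtain g where g: "bij_betw g (A - {a}) (B - {b})"
    using assms by (meson finite_Diff finite_same_card_bij)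
  have "bij_betw (g(a := b)) (A - {a}) (B - {b})"
    using g by (rule bij_betw_cong[THEN iffD1, rotated]) auto
  moreover have "bij_betw (g(a := b)) {a} {b}" by (simp add: bij_betw_def)
  ultimately have "bij_betw (g(a := b)) (A - {a} \<union> {a}) (B - {b} \<union> {b})"
    by (rule bij_betw_combine) auto
  then have "bij_betw (g(a := b)) A B"
    using assms(4,5) by (simp add: insert_absorb)
  then show ?thesis using that[of "g(a := b)"] by simp
qed

text \<open>Each block is mapped separately, with the ends of the bridge prescribed; disjointness of
  \<open>P\<close> and \<open>Q\<close> makes the combined map injective.\<close>

lemma dumbbell_embeds_iff:
  assumes "simple_graph G" "0 < m"
  shows "copies (dumbbell m) G \<noteq> {} \<longleftrightarrow>
    (\<exists>P Q x y. clique G P \<and> clique G Q \<and> card P = m \<and> card Q = m \<and> P \<inter> Q = {} \<and>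
       x \<in> P \<and> y \<in> Q \<and> {x, y} \<in> edges G)" (is "_ \<longleftrightarrow> ?R")
  unfolding copies_nonempty_iff[OF simple_graph_forbidden(1)[OF assms(2)]]
proof
  assume "\<exists>f. embeds f (dumbbell m) G"
  then obtain f where inj: "inj_on f {..<2*m}" and im: "f ` {..<2*m} \<subseteq> verts G" and
    e: "\<forall>e\<in>pairs {..<m}. f ` e \<in> edges G" "\<forall>e\<in>pairs {m..<2*m}. f ` e \<in> edges G"
      "\<forall>e\<in>pairs {0,m}. f ` e \<in> edges G"
    by (auto simp: embeds_def dumbbell_def)
  have i1: "inj_on f {..<m}" and i2: "inj_on f {m..<2*m}"
    by (auto intro!: inj_on_subset[OF inj])
  have c1: "clique G (f ` {..<m})"
    by (subst clique_image_iff[OF i1]) (use im e in auto)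
  have c2: "clique G (f ` {m..<2*m})"
    by (subst clique_image_iff[OF i2]) (use im e in auto)
  have d: "f ` {..<m} \<inter> f ` {m..<2*m} = {}"
    using inj by (auto dest: inj_onD)
  have "{0,m} \<in> pairs {0,m}" using assms(2) by (simp add: pairs_def)
  then have "{f 0, f m} \<in> edges G" using e(3) by fastforce
  moreover have "f 0 \<in> f ` {..<m}" "f m \<in> f ` {m..<2*m}" using assms(2) by auto
  ultimately show ?R using c1 c2 d card_image[OF i1] card_image[OF i2]
    by (intro exI[of _ "f ` {..<m}"] exI[of _ "f ` {m..<2*m}"] exI[of _ "f 0"] exI[of _ "f m"]) auto
next
  assume ?R
  then obtain P Q x y where PQ: "clique G P" "clique G Q" "card P = m" "card Q = m" "P \<inter> Q = {}"
       "x \<in> P" "y \<in> Q" "{x, y} \<in> edges G" by blast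
  note fin = finite_clique[OF assms(1) PQ(1)] finite_clique[OF assms(1) PQ(2)]
  obtain f where f: "bij_betw f {..<m} P" "f 0 = x"
    by (rule bij_betw_with_value[of "{..<m}" P 0 x]) (use fin PQ assms(2) in auto)
  obtain g where g: "bij_betw g {m..<2*m} Q" "g m = y"
    by (rule bij_betw_with_value[of "{m..<2*m}" Q m y]) (use fin PQ assms(2) in auto)
  define h where "h = (\<lambda>i. if i \<in> {..<m} then f i else g i)"
  have h1: "bij_betw h {..<m} P"
    using f(1) by (rule bij_betw_cong[THEN iffD1, rotated]) (auto simp: h_def)
  have h2: "bij_betw h {m..<2*m} Q"
    using g(1) by (rule bij_betw_cong[THEN iffD1, rotated]) (auto simp: h_def)
  have u: "{..<m} \<union> {m..<2*m} = {..<2*m}" by auto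
  have hb: "bij_betw h {..<2*m} (P \<union> Q)"
    using bij_betw_combine[OF h1 h2 PQ(5)] u by simp
  have "{h 0, h m} \<in> edges G" using PQ(8) f(2) g(2) assms(2) by (simp add: h_def)
  then have "\<forall>e\<in>pairs {0, m}. h ` e \<in> edges G" using assms(2) by (simp add: pairs_doubleton)
  moreover have "\<forall>e\<in>pairs {..<m}. h ` e \<in> edges G"
    using clique_image_iff[of h "{..<m}" G] h1 PQ(1) by (auto simp: bij_betw_def clique_def)
  moreover have "\<forall>e\<in>pairs {m..<2*m}. h ` e \<in> edges G"
    using clique_image_iff[of h "{m..<2*m}" G] h2 PQ(2) by (auto simp: bij_betw_def clique_def)
  ultimately show "\<exists>f. embeds f (dumbbell m) G"
    using hb PQ(1,2) unfolding embeds_def dumbbell_def bij_betw_def clique_def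
    by (intro exI[of _ h] conjI) (simp_all add: ball_Un)
qed

lemma clique_apex_embeds_iff:
  assumes "simple_graph G" "r \<le> m" "0 < m"
  shows "copies (clique_apex m r) G \<noteq> {} \<longleftrightarrow>
    (\<exists>P z W. clique G P \<and> card P = m \<and> z \<in> verts G - P \<and> W \<subseteq> P \<and> card W = r \<and>
       (\<forall>w\<in>W. {z, w} \<in> edges G))" (is "_ \<longleftrightarrow> ?R")
  unfolding copies_nonempty_iff[OF simple_graph_forbidden(2)[OF assms(3,2)]]
proof
  assume "\<exists>f. embeds f (clique_apex m r) G"
  then obtain f where inj: "inj_on f {..m}" and im: "f ` {..m} \<subseteq> verts G" and
    e: "\<forall>e\<in>pairs {..<m}. f ` e \<in> edges G" "\<forall>e\<in>pairs (insert m {..<r}). f ` e \<in> edges G"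
    by (auto simp: embeds_def clique_apex_def)
  have i1: "inj_on f {..<m}" and i2: "inj_on f {..<r}"
    using assms by (auto intro!: inj_on_subset[OF inj])
  have c1: "clique G (f ` {..<m})"
    by (subst clique_image_iff[OF i1]) (use im e in auto)
  have d: "f m \<notin> f ` {..<m}"
    using inj by (auto dest: inj_onD)
  have "{f m, f i} \<in> edges G" if "i < r" for i
  proof -
    have "{m, i} \<in> pairs (insert m {..<r})" using that assms(2) by (auto simp: pairs_iff)
    then show ?thesis using e(2) by fastforce
  qed
  then show ?R using c1 d card_image[OF i1] card_image[OF i2] im assms(2)
    by (intro exI[of _ "f ` {..<m}"] exI[of _ "f m"] exI[of _ "f ` {..<r}"]) auto
next
  assume ?R
  then obtain P z W where PQ: "clique G P" "card P = m" "z \<in> verts G" "z \<notin> P" "W \<subseteq> P" "card W = r"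
       "\<forall>w\<in>W. {z, w} \<in> edges G" by blast
  note fin = finite_clique[OF assms(1) PQ(1)]
  have finW: "finite W" using fin PQ(5) finite_subset by blast
  obtain f where f: "bij_betw f {..<r} W"
    using finW PQ(6) by (metis atLeast0LessThan ex_bij_betw_nat_finite)
  have "card {r..<m} = card (P - W)" using PQ finW by (simp add: card_Diff_subset)
  then obtain g where g: "bij_betw g {r..<m} (P - W)"
    using fin by (meson finite_Diff finite_atLeastLessThan finite_same_card_bij)
  \<comment> \<open>Pieced together so that the \<open>r\<close> neighbours of the apex land in
    \<open>W\<close> and the other vertices of the large clique in \<open>P - W\<close>.\<close>
  define h where "h = (\<lambda>i. if i < r then f i else if i < m then g i else z)"
  have h1: "bij_betw h {..<r} W"
    using f(1) by (rule bij_betw_cong[THEN iffD1, rotated]) (auto simp: h_def)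
  have h2: "bij_betw h {r..<m} (P - W)"
    using g(1) by (rule bij_betw_cong[THEN iffD1, rotated]) (auto simp: h_def)
  have u: "{..<r} \<union> {r..<m} = {..<m}" "W \<union> (P - W) = P" using assms PQ(5) by auto
  have hb: "bij_betw h {..<m} P"
    using bij_betw_combine[OF h1 h2] u by simp
  have hm: "h m = z" using assms by (simp add: h_def)
  have im: "h ` {..<m} = P" and inj: "inj_on h {..<m}" using hb by (auto simp: bij_betw_def)
  have imr: "h ` {..<r} = W" using h1 by (auto simp: bij_betw_def)
  have eq: "{..m} = insert m {..<m}" by auto
  have inj': "inj_on h {..m}" unfolding eq using inj im hm PQ(4) by (auto simp: inj_on_insert)
  have cl: "\<forall>e\<in>pairs {..<m}. h ` e \<in> edges G"
    using clique_image_iff[OF inj, of G] im PQ(1) by (auto simp: clique_def)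
  have "clique G (h ` insert m {..<r})"
    using clique_insert[OF clique_subset[OF PQ(1,5)] PQ(3)] PQ(7) by (auto simp: hm imr)
  moreover have "inj_on h (insert m {..<r})"
    by (rule inj_on_subset[OF inj']) (use assms in auto)
  moreover have "h ` insert m {..<r} \<subseteq> verts G"
    using PQ hm imr by (auto simp: clique_def)
  ultimately have "\<forall>e\<in>pairs (insert m {..<r}). h ` e \<in> edges G"
    using clique_image_iff by blast
  then show "\<exists>f. embeds f (clique_apex m r) G"
    using cl inj' im hm PQ(1,3) unfolding embeds_def clique_apex_def
    by (intro exI[of _ h]) (auto simp: clique_def eq)
qed

lemma glued_cliques_embeds_iff:
  assumes "simple_graph G" "r \<le> m" "0 < m"
  shows "copies (glued_cliques m r) G \<noteq> {} \<longleftrightarrow>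
    (\<exists>P Q x. clique G P \<and> clique G Q \<and> card P = m \<and> card Q = m - r + 2 \<and> P \<inter> Q = {x})"
    (is "_ \<longleftrightarrow> ?R")
  unfolding copies_nonempty_iff[OF simple_graph_forbidden(3)[OF assms(3,2)]]
proof
  let ?B = "{m..<2*m-r+1}"
  assume "\<exists>f. embeds f (glued_cliques m r) G"
  then obtain f where inj: "inj_on f {..<2*m-r+1}" and im: "f ` {..<2*m-r+1} \<subseteq> verts G" and
    e: "\<forall>e\<in>pairs {..<m}. f ` e \<in> edges G" "\<forall>e\<in>pairs (insert 0 ?B). f ` e \<in> edges G"
    by (auto simp: embeds_def glued_cliques_def)
  have s: "{..<m} \<subseteq> {..<2*m-r+1}" "insert 0 ?B \<subseteq> {..<2*m-r+1}" using assms by auto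
  note i1 = inj_on_subset[OF inj s(1)] and i2 = inj_on_subset[OF inj s(2)]
  have c1: "clique G (f ` {..<m})"
    using clique_image_iff[OF i1] e(1) image_mono[OF s(1), of f] im by blast
  have c2: "clique G (f ` insert 0 ?B)"
    using clique_image_iff[OF i2] e(2) image_mono[OF s(2), of f] im by blast
  have "{..<m} \<inter> insert 0 ?B = {0}" using assms by auto
  then have d: "f ` {..<m} \<inter> f ` insert 0 ?B = {f 0}"
    using inj_on_image_Int[OF inj s] by (metis image_empty image_insert)
  have "card (insert 0 ?B) = m - r + 2" using assms by (simp add: card_insert_if)
  then show ?R using c1 c2 d card_image[OF i1] card_image[OF i2] 
    by (intro exI[of _ "f ` {..<m}"] exI[of _ "f ` insert 0 ?B"] exI[of _ "f 0"] conjI)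
      (simp_all del: image_insert)
next
  let ?B = "{m..<2*m-r+1}"
  assume ?R
  then obtain P Q x where PQ: "clique G P" "clique G Q" "card P = m" "card Q = m - r + 2"
     "P \<inter> Q = {x}" by blast
  note fin = finite_clique[OF assms(1) PQ(1)] finite_clique[OF assms(1) PQ(2)]
  have x: "x \<in> P" "x \<in> Q" using PQ(5) by auto
  obtain f where f: "bij_betw f {..<m} P" "f 0 = x"
    by (rule bij_betw_with_value[of "{..<m}" P 0 x]) (use fin PQ assms x in auto)
  have "card ?B = card (Q - {x})" using PQ(4) x fin assms by simp
  then obtain g where g: "bij_betw g ?B (Q - {x})"
    using fin by (meson finite_Diff finite_atLeastLessThan finite_same_card_bij)
  define h where "h = (\<lambda>i. if i \<in> {..<m} then f i else g i)"
  have h1: "bij_betw h {..<m} P"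
    using f(1) by (rule bij_betw_cong[THEN iffD1, rotated]) (auto simp: h_def)
  have h2: "bij_betw h ?B (Q - {x})"
    using g(1) by (rule bij_betw_cong[THEN iffD1, rotated]) (auto simp: h_def)
  have u: "{..<m} \<union> ?B = {..<2*m-r+1}" using assms by auto
  have "P \<inter> (Q - {x}) = {}" using PQ(5) by auto
  moreover have "P \<union> (Q - {x}) = P \<union> Q" using x by auto
  ultimately have hb: "bij_betw h {..<2*m-r+1} (P \<union> Q)"
    using bij_betw_combine[OF h1 h2] u by metis
  have h0: "h 0 = x" using assms f by (simp add: h_def)
  have im2: "h ` insert 0 ?B = Q" using h2 x h0 by (auto simp: bij_betw_def)
  have s: "insert 0 ?B \<subseteq> {..<2*m-r+1}" using assms by auto
  have "inj_on h (insert 0 ?B)" using hb inj_on_subset[OF _ s] by (auto simp: bij_betw_def)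
  then have "\<forall>e\<in>pairs (insert 0 ?B). h ` e \<in> edges G"
    using clique_image_iff[of h "insert 0 ?B" G] im2 PQ(2) by (auto simp: clique_def)
  moreover have "\<forall>e\<in>pairs {..<m}. h ` e \<in> edges G"
    using clique_image_iff[of h "{..<m}" G] h1 PQ(1) by (auto simp: bij_betw_def clique_def)
  ultimately show "\<exists>f. embeds f (glued_cliques m r) G"
    using hb PQ(1,2) unfolding embeds_def glued_cliques_def bij_betw_def clique_def
    by (intro exI[of _ h] conjI) (simp_all add: ball_Un del: image_insert)
qed

section \<open>Saturated graphs\<close>

lemma binomial_le_binomial_diff:
  fixes N k s :: nat
  assumes "s \<le> N" "0 < k"
  shows "N choose k \<le> ((N - s) choose k) + s * ((N - 1) choose (k - 1))"
  using assms(1)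
proof (induction s)
  case (Suc s)
  obtain j where j: "k = Suc j" using assms(2) by (cases k) auto
  \<comment> \<open>Pascal's rule loses one term per removed element, and each such term is at most
    the first one.\<close>
  have "N - s = Suc (N - Suc s)" using Suc.prems by simp
  then have "(N - s) choose k = ((N - Suc s) choose j) + ((N - Suc s) choose k)"
    by (simp add: j)
  moreover have "(N - Suc s) choose j \<le> (N - 1) choose j"
    by (rule binomial_right_mono) simp
  ultimately show ?case using Suc by (simp add: j)
qed simp

text \<open>A vertex of an isolated \<open>K_m\<close> lies in \<open>(m - 1) choose (r - 1)\<close>
  copies of \<open>K_r\<close>; a vertex joined to a \<open>K_(m-r)\<close> is sure of only
  \<open>(m - r) choose (r - 1)\<close>. The cubic bound on \<open>m\<close> brings the two so close
  that the factor \<open>(2 * r - 1) / (2 * (r - 1)) > 1\<close> covers both the gap and the extra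
  1.\<close>

lemma binomial_ratio_bound:
  fixes r m :: nat
  assumes "2 \<le> r" "4 * r ^ 3 \<le> m"
  shows "2 * (r - 1) * (((m - 1) choose (r - 1)) + 1) \<le> (2 * r - 1) * ((m - r) choose (r - 1))"
proof -
  define p where "p = r - 1"
  define t where "t = (m - 1) choose p"
  define k where "k = (m - r) choose p"
  define c where "c = (m - 2) choose (p - 1)"
  have p: "1 \<le> p" "r = p + 1" using assms(1) by (auto simp: p_def)
  have "r ^ 3 = p ^ 3 + 3 * p ^ 2 + 3 * p + 1"
    by (simp add: p(2) power3_eq_cube power2_eq_square algebra_simps)
  with assms(2) have m: "2 * p ^ 3 + 3 * p ^ 2 + 3 * p + 1 \<le> m - 1" by linarith
  then have mr: "p \<le> m - 1" by linarith
  have "p - 1 \<le> m - 2" using mr by linarith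
  then have c1: "1 \<le> c" by (simp add: c_def Suc_le_eq)
  have mm: "m - 1 - p = m - r" "m - 1 - 1 = m - 2" using p by auto
  have 1: "t \<le> k + p * c"
    using binomial_le_binomial_diff[OF mr, of p] p(1) unfolding t_def k_def c_def mm by simp
  have 2: "p * t = (m - 1) * c"
    using binomial_absorption[of "p - 1" "m - 1"] p(1) by (simp add: t_def c_def numeral_2_eq_2)
  \<comment> \<open>The factor \<open>p\<close> permits replacing \<open>p * t\<close> by
    \<open>(m - 1) * c\<close>; the coefficient of \<open>c\<close> is then compared with the cubic
    lower bound on \<open>m - 1\<close>.\<close>
  have "p * (2 * p + (2 * p + 1) * p * c) \<le> p * t"
  proof -
    have "p * (2 * p + (2 * p + 1) * p * c) = 2 * p ^ 2 + (2 * p ^ 3 + p ^ 2) * c"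
      by (simp add: power3_eq_cube power2_eq_square algebra_simps)
    also have "\<dots> \<le> 2 * p ^ 2 * c + (2 * p ^ 3 + p ^ 2) * c" using c1 by simp
    also have "\<dots> = (2 * p ^ 3 + 3 * p ^ 2) * c" by (simp add: algebra_simps)
    also have "\<dots> \<le> (m - 1) * c" by (rule mult_right_mono) (use m in linarith)+
    finally show ?thesis using 2 by simp
  qed
  then have 3: "2 * p + (2 * p + 1) * p * c \<le> t" using p(1) by simp
  have "(2 * p + 1) * t \<le> (2 * p + 1) * (k + p * c)" using 1 by (rule mult_left_mono) simp
  then have "(2 * p + 1) * t \<le> (2 * p + 1) * k + (2 * p + 1) * p * c"
    by (simp add: algebra_simps)
  moreover have "(2 * p + 1) * t = 2 * p * t + t" by simp
  ultimately have "2 * p * (t + 1) \<le> (2 * p + 1) * k"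
    using 3 by (simp add: algebra_simps)
  moreover have "2 * r - 1 = 2 * p + 1" using p by simp
  ultimately show ?thesis by (simp add: t_def k_def p_def)
qed

definition forbidden_family :: "nat \<Rightarrow> nat \<Rightarrow> graph set" where
  "forbidden_family r m = {dumbbell m, clique_apex m r, glued_cliques m r}"

section \<open>Cliques created by an added edge\<close>

lemma simple_graph_add_edge:
  assumes "simple_graph G" "x \<in> verts G" "y \<in> verts G" "x \<noteq> y"
  shows "simple_graph (add_edge G x y)"
  using assms by (auto simp: simple_graph_def add_edge_def)

lemma clique_add_edge:
  assumes "clique (add_edge G x y) S" "\<not> (x \<in> S \<and> y \<in> S)"
  shows "clique G S"
  using assms unfolding clique_iff add_edge_def by (auto simp: doubleton_eq_iff)

text \<open>A clique that loses either end of the new edge is a clique of \<open>G\<close>; removing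
  both ends leaves only common neighbours of \<open>x\<close> and \<open>y\<close>.\<close>

lemma clique_add_edge_common_neighbours:
  assumes "clique (add_edge G x y) S" "x \<in> S" "y \<in> S" "x \<noteq> y" "finite S" "k + 2 \<le> card S"
  shows "\<exists>Z. clique G Z \<and> card Z = k \<and> (\<forall>z\<in>Z. {x, z} \<in> edges G \<and> {y, z} \<in> edges G)"
proof -
  have cx: "clique G (S - {x})" and cy: "clique G (S - {y})"
    using clique_add_edge[OF clique_subset[OF assms(1)]] by auto
  have "card (S - {x, y}) = card S - 2" using assms by (subst card_Diff_subset) auto
  then have "k \<le> card (S - {x, y})" using assms(6) by simp
  then obtain Z where Z: "Z \<subseteq> S - {x, y}" "card Z = k"
    by (meson obtain_subset_with_card_n)
  have "clique G Z" by (rule clique_subset[OF cx]) (use Z in auto)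
  moreover have "{x, z} \<in> edges G \<and> {y, z} \<in> edges G" if "z \<in> Z" for z
    using clique_edge[OF cy, of x z] clique_edge[OF cx, of y z] that Z(1) assms(2,3,4) by auto
  ultimately show ?thesis using Z(2) by blast
qed

locale saturated_graph =
  fixes G :: graph and r m :: nat
  assumes simple: "simple_graph G" and r_ge: "3 \<le> r" and m_ge: "4 * r ^ 3 \<le> m"
    and sat: "saturated (forbidden_family r m) G"
begin

definition "K = {P. clique G P \<and> card P = m}"
definition "R = verts G - \<Union>K"
definition "rcliques = {S. clique G S \<and> card S = r}"
text \<open>\<open>T\<close> distributes the copies of \<open>K_r\<close> over the vertices.
  \<open>\<tau>\<close> is its value at a vertex whose component is a \<open>K_m\<close>;
  \<open>\<kappa>\<close> is the number of \<open>K_r\<close> that a vertex forms with a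
  \<open>K_(m-r)\<close> in its neighbourhood.\<close>

definition "T v = card {S \<in> rcliques. v \<in> S}"
definition "\<tau> = (m - 1) choose (r - 1)"
definition "\<kappa> = (m - r) choose (r - 1)"

lemma m_bounds: "3 * r \<le> m" "r \<le> m" "0 < m" "0 < r" "r - 1 \<le> m - r"
proof -
  have "4 * r \<le> m" using self_le_power[of r 3] r_ge m_ge by linarith
  then show "3 * r \<le> m" "r \<le> m" "0 < m" "0 < r" "r - 1 \<le> m - r" using r_ge by auto
qed

lemma finite_verts: "finite (verts G)" using simple by (simp add: simple_graph_def)

lemma edge_distinct: "{x, y} \<in> edges G \<Longrightarrow> x \<noteq> y"
  using simple by (auto simp: simple_graph_def)

lemma finite_rcliques: "finite rcliques"
  by (rule finite_subset[of _ "Pow (verts G)"]) (auto simp: rcliques_def clique_def finite_verts)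

lemma K_D: "P \<in> K \<Longrightarrow> clique G P" "P \<in> K \<Longrightarrow> card P = m" "P \<in> K \<Longrightarrow> finite P"
    "P \<in> K \<Longrightarrow> P \<subseteq> verts G"
  using finite_clique[OF simple] by (auto simp: K_def clique_def)

section \<open>Copies of \<open>K_m\<close> in a saturated graph\<close>

lemma no_dumbbell:
  assumes "P \<in> K" "Q \<in> K" "P \<inter> Q = {}" "x \<in> P" "y \<in> Q"
  shows "{x, y} \<notin> edges G"
proof -
  have "copies (dumbbell m) G = {}" using sat by (auto simp: saturated_def forbidden_family_def)
  then show ?thesis using dumbbell_embeds_iff[OF simple m_bounds(3)] assms unfolding K_def by blast
qed

lemma no_clique_apex:
  assumes "P \<in> K" "z \<in> verts G - P"
  shows "card {w \<in> P. {z, w} \<in> edges G} < r"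
proof (rule ccontr)
  assume "\<not> ?thesis"
  then obtain W where W: "W \<subseteq> {w \<in> P. {z, w} \<in> edges G}" "card W = r"
    by (meson linorder_not_less obtain_subset_with_card_n)
  have "copies (clique_apex m r) G = {}" using sat by (auto simp: saturated_def forbidden_family_def)
  then show False using clique_apex_embeds_iff[OF simple m_bounds(2,3)] assms W unfolding K_def
    by blast
qed

lemma no_glued_cliques:
  assumes "P \<in> K" "clique G Q" "card Q = m - r + 2"
  shows "P \<inter> Q \<noteq> {x}"
proof -
  have "copies (glued_cliques m r) G = {}" using sat by (auto simp: saturated_def forbidden_family_def)
  then show ?thesis using glued_cliques_embeds_iff[OF simple m_bounds(2,3)] assms unfolding K_def by blast
qed

text \<open>Let \<open>P\<close> and \<open>Q\<close> share \<open>x\<close>. A vertex of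
  \<open>Q - P\<close> sees all of \<open>P \<inter> Q\<close>, which therefore has fewer than
  \<open>r\<close> elements. Then \<open>Q - P\<close> has at least \<open>m - r + 1\<close>, and
  these with \<open>x\<close> form a clique meeting \<open>P\<close> in \<open>x\<close> alone;
  hence the size \<open>m - r + 2\<close> in \<open>glued_cliques\<close>.\<close>

lemma K_disjoint:
  assumes "P \<in> K" "Q \<in> K" "P \<noteq> Q"
  shows "P \<inter> Q = {}"
proof (rule ccontr)
  assume "P \<inter> Q \<noteq> {}"
  then obtain x where x: "x \<in> P" "x \<in> Q" by blast
  note P = K_D[OF assms(1)] and Q = K_D[OF assms(2)]
  have "\<not> Q \<subseteq> P" using P Q assms(3) by (metis card_subset_eq)
  then obtain z where z: "z \<in> Q" "z \<notin> P" by blast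
  have "P \<inter> Q \<subseteq> {w \<in> P. {z, w} \<in> edges G}"
    using clique_edge[OF Q(1) z(1)] z by auto
  then have "card (P \<inter> Q) \<le> card {w \<in> P. {z, w} \<in> edges G}"
    using P(3) by (intro card_mono) auto
  also have "\<dots> < r" using no_clique_apex[OF assms(1)] z Q(4) by blast
  finally have "card (P \<inter> Q) < r" .
  moreover have "card (Q - P) = m - card (P \<inter> Q)"
    using Q P(3) by (subst Int_commute, subst card_Diff_subset_Int) auto
  ultimately have "m - r + 1 \<le> card (Q - P)" using m_bounds by linarith
  then obtain W where W: "W \<subseteq> Q - P" "card W = m - r + 1"
    by (meson obtain_subset_with_card_n)
  have fW: "finite W" using W(1) Q(3) by (meson finite_Diff finite_subset)
  have "x \<notin> W" using W(1) x(1) by blast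
  then have "card (insert x W) = m - r + 2" using W fW by simp
  moreover have "clique G (insert x W)"
    using clique_subset[OF Q(1)] W(1) x(2) by (meson Diff_subset insert_subsetI subset_trans)
  moreover have "P \<inter> insert x W = {x}" using W(1) x by blast
  ultimately show False using no_glued_cliques[OF assms(1)] by blast
qed

lemma R_not_in_clique: "x \<in> R \<Longrightarrow> clique G P \<Longrightarrow> card P = m \<Longrightarrow> x \<notin> P"
  by (auto simp: R_def K_def)

text \<open>If the new edge lies in one of the cliques of size \<open>m\<close> or
  \<open>m - r + 2\<close> of the created copy, its ends have a common \<open>K_(m-r)\<close>.
  Otherwise it is a bridge or an apex edge; as \<open>x\<close> lies in no \<open>K_m\<close>, only
  an apex edge from \<open>x\<close> into a \<open>K_m\<close> containing \<open>y\<close> is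
  left.\<close>

lemma saturation_step:
  assumes x: "x \<in> R" and y: "y \<in> verts G" and xy: "x \<noteq> y" "{x, y} \<notin> edges G"
  shows "(\<exists>Z. clique G Z \<and> card Z = m - r \<and> (\<forall>z\<in>Z. {x, z} \<in> edges G \<and> {y, z} \<in> edges G)) \<or>
    (\<exists>P\<in>K. y \<in> P \<and> r - 1 \<le> card {w \<in> P. {x, w} \<in> edges G})" (is "?A \<or> ?B")
proof -
  let ?H = "add_edge G x y"
  have xv: "x \<in> verts G" using x by (auto simp: R_def)
  have sH: "simple_graph ?H" by (rule simple_graph_add_edge[OF simple xv y xy(1)])
  have A: ?A if "clique ?H S" "\<not> clique G S" "m - r + 2 \<le> card S" for S
  proof -
    have "x \<in> S" "y \<in> S" using clique_add_edge that by blast+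
    then show ?thesis
      using clique_add_edge_common_neighbours[OF that(1) _ _ xy(1) finite_clique[OF sH that(1)]] that(3)
      by blast
  qed
  have m2: "m - r + 2 \<le> m" using r_ge m_bounds by linarith
  have "copies (dumbbell m) ?H \<noteq> {} \<or> copies (clique_apex m r) ?H \<noteq> {} \<or> copies (glued_cliques m r) ?H \<noteq> {}"
    using sat xv y xy unfolding saturated_def forbidden_family_def by blast
  then show ?thesis
  proof (elim disjE)
    assume "copies (dumbbell m) ?H \<noteq> {}"
    then obtain P Q a b where PQ: "clique ?H P" "clique ?H Q" "card P = m" "card Q = m" "P \<inter> Q = {}"
      "a \<in> P" "b \<in> Q" "{a, b} \<in> edges ?H"
      using dumbbell_embeds_iff[OF sH m_bounds(3)] by blast
    show ?thesis
    proof (cases "clique G P \<and> clique G Q")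
      case True
      then have "P \<in> K" "Q \<in> K" using PQ by (auto simp: K_def)
      then have "{a, b} \<notin> edges G" using no_dumbbell PQ by blast
      then have "{a, b} = {x, y}" using PQ(8) by (auto simp: add_edge_def)
      then have "x \<in> P \<or> x \<in> Q" using PQ by (auto simp: doubleton_eq_iff)
      then show ?thesis using R_not_in_clique[OF x] True PQ by blast
    next
      case False
      then show ?thesis using A PQ m2 by metis
    qed
  next
    assume "copies (clique_apex m r) ?H \<noteq> {}"
    then obtain P z W where PW: "clique ?H P" "card P = m" "z \<in> verts ?H - P" "W \<subseteq> P" "card W = r"
       "\<forall>w\<in>W. {z, w} \<in> edges ?H"
      using clique_apex_embeds_iff[OF sH m_bounds(2,3)] by blast
    show ?thesis
    proof (cases "clique G P")
      case True
      then have P: "P \<in> K" using PW by (simp add: K_def)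
      have zP: "z \<in> verts G - P" using PW by (simp add: add_edge_def)
      have fP: "finite P" using K_D(3)[OF P] .
      have "\<not> W \<subseteq> {w \<in> P. {z, w} \<in> edges G}"
      proof
        assume "W \<subseteq> {w \<in> P. {z, w} \<in> edges G}"
        then have "card W \<le> card {w \<in> P. {z, w} \<in> edges G}" using fP by (intro card_mono) auto
        then show False using no_clique_apex[OF P zP] PW(5) by simp
      qed
      then obtain w where w: "w \<in> W" "{z, w} \<notin> edges G" using PW(4) by blast
      then have "{z, w} = {x, y}" using PW(6) by (auto simp: add_edge_def)
      \<comment> \<open>Excludes the reversed reading of the edge, with \<open>y\<close> as the
        apex.\<close>
      moreover have "x \<notin> P" by (rule R_not_in_clique[OF x True PW(2)])
      ultimately have zw: "z = x" "w = y" using w PW(4) by (auto simp: doubleton_eq_iff)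
      have "W - {y} \<subseteq> {w \<in> P. {x, w} \<in> edges G}"
        using PW(4,6) zw by (auto simp: add_edge_def doubleton_eq_iff)
      then have "card (W - {y}) \<le> card {w \<in> P. {x, w} \<in> edges G}"
        using fP by (intro card_mono) auto
      moreover have "card (W - {y}) = r - 1" using PW(5) w zw by simp
      ultimately show ?thesis using P w zw PW(4) by auto
    next
      case False
      then show ?thesis using A PW m2 by metis
    qed
  next
    assume "copies (glued_cliques m r) ?H \<noteq> {}"
    then obtain P Q a where PQ: "clique ?H P" "clique ?H Q" "card P = m" "card Q = m - r + 2"
       "P \<inter> Q = {a}"
      using glued_cliques_embeds_iff[OF sH m_bounds(2,3)] by blast
    have "\<not> (clique G P \<and> clique G Q)"
      using no_glued_cliques PQ unfolding K_def by blast
    then show ?thesis using A PQ m2 by (metis order_refl)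
  qed
qed

text \<open>Take \<open>u\<close> in \<open>R\<close>. If \<open>u\<close> has \<open>r - 1\<close>
  neighbours in \<open>P\<close>, these and \<open>u\<close> suffice. Otherwise \<open>u\<close> and
  a non-neighbour \<open>q\<close> in \<open>P\<close> have a common clique \<open>Z\<close> on
  \<open>m - r\<close> vertices. Since \<open>3 * r \<le> m\<close>, \<open>Z\<close> has
  \<open>r - 1\<close> vertices inside \<open>P\<close>, to be completed by \<open>u\<close>, or
  outside \<open>P\<close>, to be completed by \<open>q\<close>.\<close>

lemma K_meets_crossing_rclique:
  assumes P: "P \<in> K" and "R \<noteq> {}"
  shows "\<exists>S\<in>rcliques. S \<inter> P \<noteq> {} \<and> \<not> S \<subseteq> P"
proof -
  obtain u where u: "u \<in> R" using assms by blast
  have uP: "u \<notin> P" "u \<in> verts G" using u P by (auto simp: R_def)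
  note KP = K_D[OF P]
  have ext: ?thesis
    if W: "clique G W" "r - 1 \<le> card W" and x: "x \<in> verts G" "x \<notin> W" "\<forall>w\<in>W. {x, w} \<in> edges G"
      and "(W \<subseteq> P \<and> x \<notin> P) \<or> (W \<inter> P = {} \<and> x \<in> P)" for W x
  proof -
    obtain W' where W': "W' \<subseteq> W" "card W' = r - 1" using W(2) by (meson obtain_subset_with_card_n)
    have f: "finite W'" using finite_clique[OF simple clique_subset[OF W(1) W'(1)]] .
    have "insert x W' \<in> rcliques"
      unfolding rcliques_def using clique_insert[OF clique_subset[OF W(1) W'(1)] x(1)] x W' f r_ge
      by (auto simp: card_insert_if)
    moreover have "W' \<noteq> {}" using W'(2) r_ge by auto
    ultimately show ?thesis using that(6) W'(1) by (intro bexI[of _ "insert x W'"]) auto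
  qed
  have attached: ?thesis if "r - 1 \<le> card {w \<in> P. {u, w} \<in> edges G}"
    by (rule ext[of "{w \<in> P. {u, w} \<in> edges G}" u])
      (use that uP clique_subset[OF KP(1)] in auto)
  show ?thesis
  proof (cases "\<forall>q\<in>P. {u, q} \<in> edges G")
    case True
    then have "{w \<in> P. {u, w} \<in> edges G} = P" by blast
    then show ?thesis using attached KP(2) m_bounds by simp
  next
    case False
    then obtain q where q: "q \<in> P" "{u, q} \<notin> edges G" by blast
    have "q \<in> verts G" "u \<noteq> q" using q KP uP by auto
    from saturation_step[OF u this q(2)] show ?thesis
    proof (elim disjE exE conjE bexE)
      fix Q assume Q: "Q \<in> K" "q \<in> Q" "r - 1 \<le> card {w \<in> Q. {u, w} \<in> edges G}"
      then have "Q = P" using K_disjoint[OF P Q(1)] q by blast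
      then show ?thesis using attached Q by simp
    next
      fix Z assume Z: "clique G Z" "card Z = m - r" "\<forall>z\<in>Z. {u, z} \<in> edges G \<and> {q, z} \<in> edges G"
      have fZ: "finite Z" using finite_clique[OF simple Z(1)] .
      have sum: "card (Z \<inter> P) + card (Z - P) = m - r"
        using fZ Z(2) by (metis card_Int_Diff)
      have nz: "u \<notin> Z" "q \<notin> Z" using Z(3) edge_distinct by blast+
      show ?thesis
      proof (cases "r - 1 \<le> card (Z \<inter> P)")
        case True
        show ?thesis
          by (rule ext[of "Z \<inter> P" u]) (use True uP nz Z clique_subset[OF Z(1)] in auto)
      next
        case False
        then have "r - 1 \<le> card (Z - P)" using sum m_bounds by linarith
        then show ?thesis
          by (rule ext[of "Z - P" q, rotated 1]) (use q KP nz Z clique_subset[OF Z(1)] in auto)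
      qed
    qed
  qed
qed

section \<open>Incidences on the copies of \<open>K_m\<close>\<close>

lemma T_ge_in_K:
  assumes P: "P \<in> K" and v: "v \<in> P"
  shows "\<tau> \<le> card {S \<in> rcliques. v \<in> S \<and> S \<subseteq> P}"
proof -
  note KP = K_D[OF P]
  let ?B = "{B. B \<subseteq> P - {v} \<and> card B = r - 1}"
  have "card ?B = \<tau>"
    using n_subsets[of "P - {v}" "r - 1"] KP v by (simp add: \<tau>_def)
  moreover have "inj_on (insert v) ?B" by (auto simp: inj_on_def) 
  moreover have "insert v ` ?B \<subseteq> {S \<in> rcliques. v \<in> S \<and> S \<subseteq> P}"
  proof
    fix S assume "S \<in> insert v ` ?B"
    then obtain B where B: "S = insert v B" "B \<subseteq> P - {v}" "card B = r - 1" by auto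
    have "finite B" "v \<notin> B" using B(2) KP(3) finite_subset by auto
    then have "card S = r" using B r_ge by simp
    moreover have "S \<subseteq> P" using B v by auto
    ultimately show "S \<in> {S \<in> rcliques. v \<in> S \<and> S \<subseteq> P}"
      using clique_subset[OF KP(1)] B by (auto simp: rcliques_def)
  qed
  ultimately show ?thesis
    using card_inj_on_le[of "insert v" ?B "{S \<in> rcliques. v \<in> S \<and> S \<subseteq> P}"] finite_rcliques by simp
qed

text \<open>The \<open>K_r\<close> inside \<open>P\<close> give \<open>\<tau>\<close> at each
  vertex, and a crossing one lifts some vertex above \<open>\<tau>\<close>. This surplus of 1 per
  \<open>K_m\<close> is what finally separates the two subsequences.\<close>

lemma sum_T_in_K:
  assumes P: "P \<in> K" and "R \<noteq> {}"
  shows "m * \<tau> + 1 \<le> sum T P"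
proof -
  obtain S x where S: "S \<in> rcliques" "x \<in> S" "x \<in> P" "\<not> S \<subseteq> P"
    using K_meets_crossing_rclique[OF assms] by blast
  note KP = K_D[OF P]
  have sub: "{S \<in> rcliques. v \<in> S \<and> S \<subseteq> P} \<subseteq> {S \<in> rcliques. v \<in> S}" for v by auto
  have le: "\<tau> \<le> T v" if "v \<in> P" for v
  proof -
    have "card {S \<in> rcliques. v \<in> S \<and> S \<subseteq> P} \<le> T v"
      unfolding T_def by (intro card_mono sub) (simp add: finite_rcliques)
    then show ?thesis using T_ge_in_K[OF P that] by linarith
  qed
  have "{S \<in> rcliques. x \<in> S \<and> S \<subseteq> P} \<subset> {S \<in> rcliques. x \<in> S}" using S by blast
  then have "card {S \<in> rcliques. x \<in> S \<and> S \<subseteq> P} < T x"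
    unfolding T_def by (intro psubset_card_mono) (auto simp: finite_rcliques)
  then have lt: "\<tau> < T x" using T_ge_in_K[OF P S(3)] by linarith
  have "sum (\<lambda>_. \<tau>) P < sum T P"
    by (rule sum_strict_mono_ex1) (use KP le lt S(3) in auto)
  then show ?thesis using KP(2) by simp
qed

text \<open>Stated for subfamilies because the copies of \<open>K_m\<close> that meet a bounded set
  will be discarded.\<close>

lemma sum_T_Union:
  assumes "L \<subseteq> K" "R \<noteq> {}"
  shows "card L * (m * \<tau> + 1) \<le> sum T (\<Union>L)"
proof -
  have "sum T (\<Union>L) = (\<Sum>P\<in>L. sum T P)"
    using sum.Union_disjoint[of L T] assms(1) K_disjoint K_D(3) by (simp add: subset_iff)
  moreover have "(\<Sum>P\<in>L. m * \<tau> + 1) \<le> (\<Sum>P\<in>L. sum T P)"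
    using sum_T_in_K assms by (intro sum_mono) blast
  ultimately show ?thesis by simp
qed

lemma card_verts: "card (verts G) = m * card K + card R"
proof -
  have "card (\<Union>K) = (\<Sum>P\<in>K. card P)"
    using K_disjoint K_D by (intro card_Union_disjoint) (auto simp: pairwise_def disjnt_def)
  also have "\<dots> = m * card K" using K_D by simp
  finally have "card (\<Union>K) = m * card K" .
  moreover have "\<Union>K \<subseteq> verts G" using K_D by blast
  ultimately show ?thesis
    unfolding R_def using finite_verts
    by (metis add_diff_inverse_nat card_Diff_subset card_mono finite_subset linorder_not_le)
qed

lemma finite_R: "finite R" by (simp add: R_def finite_verts)

text \<open>Double counting of the pairs of a vertex and a \<open>K_r\<close> containing it.\<close>

lemma sum_T_verts: "sum T (verts G) = r * card rcliques"
proof -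
  have "sum T (verts G) = (\<Sum>v\<in>verts G. \<Sum>S\<in>rcliques. if v \<in> S then 1 else 0)"
    unfolding T_def using finite_rcliques by (simp add: sum.If_cases Int_def)
  also have "\<dots> = (\<Sum>S\<in>rcliques. \<Sum>v\<in>verts G. if v \<in> S then 1 else 0)" by (rule sum.swap)
  also have "\<dots> = (\<Sum>S\<in>rcliques. r)"
  proof (rule sum.cong)
    fix S assume S: "S \<in> rcliques"
    then have "verts G \<inter> S = S" by (auto simp: rcliques_def clique_def)
    then show "(\<Sum>v\<in>verts G. if v \<in> S then 1 else 0) = r"
      using S finite_verts by (simp add: sum.If_cases Int_def rcliques_def)
  qed simp
  finally show ?thesis by simp
qed

text \<open>The constants \<open>T0\<close>, \<open>\<rho>0\<close> and \<open>C0\<close> depend on \<open>r\<close> and \<open>m\<close> only: the threshold for lying in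
  boundedly many \<open>K\<^sub>r\<close>, the size above which the greedy argument runs, and the total loss.\<close>

definition "mates v = \<Union>{S \<in> rcliques. v \<in> S} - {v}"
definition "nonadj v = {y \<in> R. y \<noteq> v \<and> {v, y} \<notin> edges G}"
definition "T0 = 4 * r * (\<tau> + 1)"
definition "\<rho>0 = 4 * r * (r * T0 + r)"
definition "C0 = m * (m * \<tau> + 1) * (r * T0) + (m * \<tau> + 1) * \<rho>0"

section \<open>Vertices of \<open>R\<close> and their non-neighbours\<close>

lemma mates_subset_verts: "mates v \<subseteq> verts G"
  unfolding mates_def rcliques_def clique_def by blast

lemma finite_mates: "finite (mates v)"
  using mates_subset_verts finite_verts by (rule finite_subset)

lemma card_mates: "card (mates v) \<le> r * T v"
proof -
  have "card (mates v) \<le> card (\<Union>{S \<in> rcliques. v \<in> S})"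
    unfolding mates_def by (rule card_Diff1_le)
  also have "\<dots> \<le> (\<Sum>S\<in>{S \<in> rcliques. v \<in> S}. card S)" by (rule card_Union_le_sum_card)
  also have "\<dots> = (\<Sum>S\<in>{S \<in> rcliques. v \<in> S}. r)"
    by (rule sum.cong) (auto simp: rcliques_def)
  finally show ?thesis by (simp add: T_def mult.commute)
qed

lemma mates_adjacent: "w \<in> mates v \<Longrightarrow> {v, w} \<in> edges G"
  unfolding mates_def rcliques_def using clique_edge by blast

text \<open>As \<open>y\<close> lies in no \<open>K_m\<close>, \<open>saturation_step\<close> must
  give a common clique \<open>Z\<close>. Each \<open>z\<close> in \<open>Z\<close> forms a
  \<open>K_r\<close> with \<open>v\<close> and \<open>r - 2\<close> further vertices of
  \<open>Z\<close>, whence \<open>Z\<close> lies in \<open>mates v\<close>, a set bounded in terms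
  of \<open>T v\<close>.\<close>

lemma common_clique_in_mates:
  assumes "v \<in> R" "y \<in> nonadj v"
  obtains Z where "Z \<subseteq> mates v" "clique G Z" "card Z = m - r" "\<And>z. z \<in> Z \<Longrightarrow> {y, z} \<in> edges G"
proof -
  have y: "y \<in> R" "v \<noteq> y" "{v, y} \<notin> edges G" using assms(2) by (auto simp: nonadj_def)
  have "y \<in> verts G" using y by (simp add: R_def)
  moreover have "\<not> (\<exists>P\<in>K. y \<in> P \<and> r - 1 \<le> card {w \<in> P. {v, w} \<in> edges G})"
    using y(1) by (auto simp: R_def)
  ultimately obtain Z where Z: "clique G Z" "card Z = m - r"
      "\<forall>z\<in>Z. {v, z} \<in> edges G \<and> {y, z} \<in> edges G"
    using saturation_step[OF assms(1) _ y(2,3)] by blast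
  have fZ: "finite Z" using finite_clique[OF simple Z(1)] .
  have vZ: "v \<notin> Z" using Z(3) edge_distinct by blast
  have "Z \<subseteq> mates v"
  proof
    fix z assume z: "z \<in> Z"
    have "r - 2 \<le> card (Z - {z})" using z fZ Z(2) m_bounds by simp
    then obtain W where W: "W \<subseteq> Z - {z}" "card W = r - 2"
      by (meson obtain_subset_with_card_n)
    have fW: "finite W" using W(1) fZ finite_subset by blast
    have sub: "insert z W \<subseteq> Z" using W z by auto
    have "clique G (insert v (insert z W))"
      using sub assms(1) Z by (intro clique_insert clique_subset[OF Z(1)]) (auto simp: R_def)
    moreover have "card (insert v (insert z W)) = r"
    proof -
      have "z \<notin> W" "v \<notin> insert z W" using W(1) sub vZ by auto
      then show ?thesis using fW W(2) r_ge by simp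
    qed
    ultimately show "z \<in> mates v" unfolding mates_def rcliques_def using vZ z by blast
  qed
  then show ?thesis using that Z by blast
qed

text \<open>A non-neighbour \<open>y\<close> forms a \<open>K_r\<close> with each of the
  \<open>\<kappa>\<close> sets of \<open>r - 1\<close> vertices in its common clique with
  \<open>v\<close>. All vertices but \<open>y\<close> are in \<open>mates v\<close>, so different
  \<open>y\<close> give different copies, and each copy contributes all its \<open>r\<close>
  incidences to \<open>mates v \<union> nonadj v\<close>.\<close>

lemma sum_T_mates_nonadj:
  assumes v: "v \<in> R"
  shows "r * \<kappa> * card (nonadj v) \<le> sum T (mates v \<union> nonadj v)"
proof -
  have fY: "finite (nonadj v)" by (simp add: nonadj_def finite_R)
  have dis: "mates v \<inter> nonadj v = {}" using mates_adjacent by (auto simp: nonadj_def)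
  define \<S> where "\<S> y = {S \<in> rcliques. y \<in> S \<and> S - {y} \<subseteq> mates v}" for y
  have fS: "finite (\<S> y)" for y by (simp add: \<S>_def finite_rcliques)
  have Sge: "\<kappa> \<le> card (\<S> y)" if y: "y \<in> nonadj v" for y
  proof -
    obtain Z where Z: "Z \<subseteq> mates v" "clique G Z" "card Z = m - r" "\<And>z. z \<in> Z \<Longrightarrow> {y, z} \<in> edges G"
      using common_clique_in_mates[OF v y] by blast
    have fZ: "finite Z" using finite_clique[OF simple Z(2)] .
    have yZ: "y \<notin> Z" using Z(4) edge_distinct by blast
    have yv: "y \<in> verts G" using y by (auto simp: nonadj_def R_def)
    let ?B = "{B. B \<subseteq> Z \<and> card B = r - 1}"
    have "card ?B = \<kappa>" using n_subsets[OF fZ, of "r - 1"] Z(3) by (simp add: \<kappa>_def)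
    moreover have "inj_on (insert y) ?B" using yZ by (auto simp: inj_on_def)
    moreover have "insert y ` ?B \<subseteq> \<S> y"
    proof
      fix S assume "S \<in> insert y ` ?B"
      then obtain B where B: "S = insert y B" "B \<subseteq> Z" "card B = r - 1" by auto
      have "finite B" "y \<notin> B" using B(2) fZ yZ finite_subset by auto
      then have "card S = r" using B r_ge by simp
      moreover have "clique G S"
        unfolding B(1) using B(2) Z yv by (intro clique_insert clique_subset[OF Z(2)]) auto
      ultimately show "S \<in> \<S> y" using B Z(1) by (auto simp: \<S>_def rcliques_def)
    qed
    ultimately show ?thesis using card_inj_on_le[of "insert y" ?B "\<S> y"] fS by simp
  qed
  define \<U> where "\<U> = (\<Union>y\<in>nonadj v. \<S> y)"
  have fU: "finite \<U>" unfolding \<U>_def using fY fS by blast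
  have "card \<U> = (\<Sum>y\<in>nonadj v. card (\<S> y))"
    unfolding \<U>_def
  proof (rule card_UN_disjoint[OF fY])
    show "\<forall>i\<in>nonadj v. finite (\<S> i)" using fS by blast
    show "\<forall>i\<in>nonadj v. \<forall>j\<in>nonadj v. i \<noteq> j \<longrightarrow> \<S> i \<inter> \<S> j = {}"
      using dis unfolding \<S>_def by blast
  qed
  moreover have "(\<Sum>y\<in>nonadj v. \<kappa>) \<le> (\<Sum>y\<in>nonadj v. card (\<S> y))" by (intro sum_mono Sge)
  ultimately have U: "\<kappa> * card (nonadj v) \<le> card \<U>" by (simp add: mult.commute)
  have fAY: "finite (mates v \<union> nonadj v)" using finite_mates fY by blast
  have "r * card \<U> = (\<Sum>S\<in>\<U>. card S)"
  proof -
    have "(\<Sum>S\<in>\<U>. card S) = (\<Sum>S\<in>\<U>. r)"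
      by (rule sum.cong) (auto simp: \<U>_def \<S>_def rcliques_def)
    then show ?thesis by simp
  qed
  also have "\<dots> = (\<Sum>S\<in>\<U>. \<Sum>w\<in>mates v \<union> nonadj v. if w \<in> S then 1 else 0)"
  proof (rule sum.cong)
    fix S assume "S \<in> \<U>"
    then have "(mates v \<union> nonadj v) \<inter> S = S" by (auto simp: \<U>_def \<S>_def)
    then show "card S = (\<Sum>w\<in>mates v \<union> nonadj v. if w \<in> S then 1 else 0)"
      using fAY by (simp add: sum.If_cases)
  qed simp
  also have "\<dots> = (\<Sum>w\<in>mates v \<union> nonadj v. \<Sum>S\<in>\<U>. if w \<in> S then 1 else 0)" by (rule sum.swap)
  also have "\<dots> \<le> sum T (mates v \<union> nonadj v)"
  proof (rule sum_mono)
    fix w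
    have "(\<Sum>S\<in>\<U>. if w \<in> S then 1 else 0) = card {S \<in> \<U>. w \<in> S}"
      using fU by (simp add: sum.If_cases Int_def)
    also have "\<dots> \<le> T w"
      unfolding T_def by (intro card_mono) (auto simp: finite_rcliques \<U>_def \<S>_def)
    finally show "(\<Sum>S\<in>\<U>. if w \<in> S then 1 else 0) \<le> T w" .
  qed
  finally have "r * card \<U> \<le> sum T (mates v \<union> nonadj v)" .
  moreover have "r * (\<kappa> * card (nonadj v)) \<le> r * card \<U>" using U by (rule mult_left_mono) simp
  ultimately show ?thesis unfolding mult.assoc by (rule order_trans[rotated])
qed

section \<open>Lower bounds on the number of incidences\<close>

lemma card_K_meeting_le:
  assumes "finite B"
  shows "card {P \<in> K. P \<inter> B \<noteq> {}} \<le> card B"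
proof -
  define f where "f P = (SOME b. b \<in> P \<inter> B)" for P
  have f: "f P \<in> P \<inter> B" if "P \<inter> B \<noteq> {}" for P
    unfolding f_def using that by (metis ex_in_conv someI_ex)
  have "inj_on f {P \<in> K. P \<inter> B \<noteq> {}}"
  proof (rule inj_onI)
    fix P Q assume *: "P \<in> {P \<in> K. P \<inter> B \<noteq> {}}" "Q \<in> {P \<in> K. P \<inter> B \<noteq> {}}" "f P = f Q"
    then have "f P \<in> P \<inter> Q" using f[of P] f[of Q] by auto
    then show "P = Q" using * K_disjoint[of P Q] by auto
  qed
  moreover have "f ` {P \<in> K. P \<inter> B \<noteq> {}} \<subseteq> B" using f by auto
  ultimately show ?thesis using assms by (rule card_inj_on_le)
qed

text \<open>The copies of \<open>K_m\<close> that meet \<open>mates v\<close>, at most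
  \<open>r * T0\<close> by disjointness, are given up so that no vertex is counted twice. The others
  avoid \<open>mates v \<union> nonadj v\<close>, which alone pays \<open>\<tau> + 1\<close> for
  every vertex of \<open>R\<close>. The factor \<open>m\<close> clears the denominator in the
  average \<open>\<tau> + 1/m\<close>.\<close>

lemma sum_T_few_neighbours:
  assumes v: "v \<in> R" "T v \<le> T0" and large: "(2 * r - 1) * card R \<le> 2 * r * (r - 1) * card (nonadj v)"
  shows "(m * \<tau> + 1) * card (verts G) \<le> m * sum T (verts G) + m * (m * \<tau> + 1) * (r * T0)"
proof -
  define L where "L = {P \<in> K. P \<inter> mates v = {}}"
  have "K = L \<union> {P \<in> K. P \<inter> mates v \<noteq> {}}" by (auto simp: L_def)
  then have "card K \<le> card L + card {P \<in> K. P \<inter> mates v \<noteq> {}}" by (metis card_Un_le)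
  also have "\<dots> \<le> card L + r * T0"
    using card_K_meeting_le[OF finite_mates, of v] card_mates[of v] mult_le_mono2[OF v(2), of r] by linarith
  finally have cL: "card K \<le> card L + r * T0" .
  \<comment> \<open>\<open>large\<close> and \<open>binomial_ratio_bound\<close> both carry the
    factor \<open>2 * (r - 1)\<close>, which is cancelled afterwards.\<close>
  have "(2 * (r - 1)) * ((\<tau> + 1) * card R) \<le> (2 * (r - 1)) * (r * \<kappa> * card (nonadj v))"
  proof -
    have "(2 * (r - 1)) * ((\<tau> + 1) * card R) = (2 * (r - 1) * (\<tau> + 1)) * card R"
      by (simp only: mult.assoc)
    also have "\<dots> \<le> ((2 * r - 1) * \<kappa>) * card R"
      using binomial_ratio_bound[of r m] r_ge m_ge
      by (intro mult_right_mono) (auto simp: \<tau>_def \<kappa>_def)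
    also have "\<dots> = \<kappa> * ((2 * r - 1) * card R)" by (simp only: ac_simps)
    also have "\<dots> \<le> \<kappa> * (2 * r * (r - 1) * card (nonadj v))" using large by (rule mult_left_mono) simp
    also have "\<dots> = (2 * (r - 1)) * (r * \<kappa> * card (nonadj v))" by (simp only: ac_simps)
    finally show ?thesis .
  qed
  then have "(\<tau> + 1) * card R \<le> r * \<kappa> * card (nonadj v)" using r_ge by simp
  then have 1: "(\<tau> + 1) * card R \<le> sum T (mates v \<union> nonadj v)" using sum_T_mates_nonadj[OF v(1)] by linarith
  have "L \<subseteq> K" by (auto simp: L_def)
  then have 2: "card L * (m * \<tau> + 1) \<le> sum T (\<Union>L)" using sum_T_Union v(1) by blast
  have "\<Union>L \<inter> (mates v \<union> nonadj v) = {}" by (auto simp: L_def nonadj_def R_def)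
  moreover have "\<Union>L \<subseteq> verts G" using K_D(4) by (auto simp: L_def)
  moreover have "mates v \<union> nonadj v \<subseteq> verts G" using mates_subset_verts by (auto simp: nonadj_def R_def)
  ultimately have "sum T (\<Union>L) + sum T (mates v \<union> nonadj v) \<le> sum T (verts G)"
    using finite_verts
    by (metis Un_least finite_subset sum.union_disjoint sum_mono2 zero_le)
  with 1 2 have "card L * (m * \<tau> + 1) + (\<tau> + 1) * card R \<le> sum T (verts G)" by linarith
  then have "m * (card L * (m * \<tau> + 1) + (\<tau> + 1) * card R) \<le> m * sum T (verts G)"
    by (rule mult_left_mono) simp
  moreover have "m * card K * (m * \<tau> + 1) \<le> m * (card L + r * T0) * (m * \<tau> + 1)"
    using cL by (intro mult_right_mono mult_left_mono) auto
  moreover have "(m * \<tau> + 1) * card R \<le> m * (\<tau> + 1) * card R"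
    using m_bounds by (intro mult_right_mono) auto
  ultimately show ?thesis
    unfolding card_verts by (simp only: algebra_simps mult_1_left mult_1_right)
qed

text \<open>\<open>T0\<close> contains the factor \<open>4 * r\<close>, so a share
  \<open>1 / (4 * r)\<close> of \<open>R\<close> pays \<open>\<tau> + 1\<close> for every vertex of
  \<open>R\<close>.\<close>

lemma sum_T_many_rich:
  assumes "X \<subseteq> R" "\<And>x. x \<in> X \<Longrightarrow> T0 \<le> T x" "card R \<le> 4 * r * card X" "R \<noteq> {}"
  shows "(m * \<tau> + 1) * card (verts G) \<le> m * sum T (verts G)"
proof -
  have "(\<tau> + 1) * card R \<le> (\<tau> + 1) * (4 * r * card X)" using assms(3) by (rule mult_left_mono) simp
  also have "\<dots> = (\<Sum>x\<in>X. T0)" by (simp add: T0_def algebra_simps)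
  also have "\<dots> \<le> sum T X" by (intro sum_mono assms)
  also have "\<dots> \<le> sum T R" using assms(1) by (intro sum_mono2) (auto simp: finite_R)
  finally have 1: "(\<tau> + 1) * card R \<le> sum T R" .
  have 2: "card K * (m * \<tau> + 1) \<le> sum T (\<Union>K)" using sum_T_Union assms(4) by blast
  have "\<Union>K \<subseteq> verts G" using K_D(4) by blast
  then have "verts G = \<Union>K \<union> R" "\<Union>K \<inter> R = {}" by (auto simp: R_def)
  then have "sum T (verts G) = sum T (\<Union>K) + sum T R"
    using finite_verts by (metis finite_Un sum.union_disjoint)
  with 1 2 have "card K * (m * \<tau> + 1) + (\<tau> + 1) * card R \<le> sum T (verts G)" by linarith
  then have "m * (card K * (m * \<tau> + 1) + (\<tau> + 1) * card R) \<le> m * sum T (verts G)"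
    by (rule mult_left_mono) simp
  moreover have "(m * \<tau> + 1) * card R \<le> m * (\<tau> + 1) * card R"
    using m_bounds by (intro mult_right_mono) auto
  ultimately show ?thesis
    unfolding card_verts by (simp only: algebra_simps mult_1_left mult_1_right)
qed

text \<open>The vertices of \<open>R\<close> are credited with nothing; their bounded number goes
  into the additive constant.\<close>

lemma sum_T_small_R:
  assumes "card R \<le> \<rho>0" "R \<noteq> {}"
  shows "(m * \<tau> + 1) * card (verts G) \<le> m * sum T (verts G) + (m * \<tau> + 1) * \<rho>0"
proof -
  have "card K * (m * \<tau> + 1) \<le> sum T (\<Union>K)" using sum_T_Union assms by blast
  also have "\<dots> \<le> sum T (verts G)" using K_D(4) finite_verts by (intro sum_mono2) auto
  finally have "m * (card K * (m * \<tau> + 1)) \<le> m * sum T (verts G)" by (rule mult_left_mono) simp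
  moreover have "(m * \<tau> + 1) * card R \<le> (m * \<tau> + 1) * \<rho>0" using assms(1) by (rule mult_left_mono) simp
  ultimately show ?thesis
    unfolding card_verts by (simp only: algebra_simps mult_1_left mult_1_right)
qed

text \<open>The vertices of \<open>R\<close> to be avoided are the non-neighbours of
  \<open>C\<close>, at most a share
  \<open>(r - 1) * (2 * r - 1) / (2 * r * (r - 1)) = 1 - 1 / (2 * r)\<close>; \<open>R - X\<close>,
  less than \<open>1 / (4 * r)\<close>; and \<open>B\<close> with \<open>C\<close>, at most
  \<open>1 / (4 * r)\<close> by the choice of \<open>\<rho>0\<close>. The shares sum to less than
  1.\<close>

lemma grow_clique:
  assumes X: "X \<subseteq> R" and C: "C \<subseteq> X" "clique G C" "card C < r" and B: "finite B" "card B \<le> r * T0"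
    and dense: "4 * r * card (R - X) < card R" "\<And>x. x \<in> C \<Longrightarrow> 2 * r * (r - 1) * card (nonadj x) \<le> (2 * r - 1) * card R"
    and big: "\<rho>0 \<le> card R"
  obtains x where "x \<in> X" "x \<notin> C" "x \<notin> B" "clique G (insert x C)"
proof -
  define N where "N = (\<Union>w\<in>C. nonadj w)"
  have fC: "finite C" using finite_clique[OF simple C(2)] .
  have "2 * r * (r - 1) * card N \<le> 2 * r * (r - 1) * (\<Sum>w\<in>C. card (nonadj w))"
    unfolding N_def by (intro mult_left_mono card_UN_le fC) simp
  also have "\<dots> = (\<Sum>w\<in>C. 2 * r * (r - 1) * card (nonadj w))" by (rule sum_distrib_left)
  also have "\<dots> \<le> (\<Sum>w\<in>C. (2 * r - 1) * card R)" by (intro sum_mono dense)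
  also have "\<dots> = card C * ((2 * r - 1) * card R)" by simp
  also have "\<dots> \<le> (r - 1) * ((2 * r - 1) * card R)" using C(3) by (intro mult_right_mono) auto
  finally have "(r - 1) * (2 * r * card N) \<le> (r - 1) * ((2 * r - 1) * card R)" by (simp only: ac_simps)
  then have N: "2 * r * card N \<le> (2 * r - 1) * card R" using r_ge by simp
  have c1: "card (N \<union> (R - X) \<union> B \<union> C) \<le> card N + card (R - X) + card B + card C"
    using card_Un_le[of N "R - X"] card_Un_le[of "N \<union> (R - X)" B]
      card_Un_le[of "N \<union> (R - X) \<union> B" C] by linarith
  have "4 * r * card (N \<union> (R - X) \<union> B \<union> C) \<le> 4 * r * (card N + card (R - X) + card B + card C)"
    using c1 by (rule mult_left_mono) simp
  also have "\<dots> = 2 * (2 * r * card N) + 4 * r * card (R - X) + 4 * r * (card B + card C)"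
    by (simp add: algebra_simps)
  also have "\<dots> < 2 * ((2 * r - 1) * card R) + card R + 4 * r * (r * T0 + r)"
  proof -
    have "4 * r * (card B + card C) \<le> 4 * r * (r * T0 + r)"
      using B(2) C(3) by (intro mult_left_mono) auto
    then show ?thesis using N dense(1) by linarith
  qed
  also have "\<dots> \<le> 2 * ((2 * r - 1) * card R) + card R + card R" using big by (simp add: \<rho>0_def)
  also have "\<dots> = 2 * (((2 * r - 1) + 1) * card R)" by (simp add: algebra_simps)
  also have "\<dots> = 4 * r * card R" using r_ge by simp
  finally have "card (N \<union> (R - X) \<union> B \<union> C) < card R" by simp
  moreover have "finite (N \<union> (R - X) \<union> B \<union> C)"
    using fC B(1) finite_R by (auto simp: N_def nonadj_def)
  ultimately have "\<not> R \<subseteq> N \<union> (R - X) \<union> B \<union> C" by (meson card_mono linorder_not_le)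
  then obtain x where x: "x \<in> R" "x \<notin> N" "x \<in> X" "x \<notin> B" "x \<notin> C" by blast
  have "{x, y} \<in> edges G" if "y \<in> C" for y
    using x that by (auto simp: N_def nonadj_def insert_commute)
  then have "clique G (insert x C)" using x(1) by (intro clique_insert C(2)) (auto simp: R_def)
  then show ?thesis using that x by blast
qed

text \<open>Three cases are the bounds above. In the fourth, \<open>grow_clique\<close> extends
  \<open>{v}\<close> by vertices outside \<open>mates v\<close> to a \<open>K_r\<close>; but all
  other vertices of a \<open>K_r\<close> through \<open>v\<close> are in \<open>mates v\<close>, a
  contradiction.\<close>

lemma sum_T_lower_bound:
  assumes "R \<noteq> {}"
  shows "(m * \<tau> + 1) * card (verts G) \<le> m * sum T (verts G) + C0"
proof -
  define X where "X = {x \<in> R. T x \<le> T0}"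
  consider "card R \<le> \<rho>0" | "card R \<le> 4 * r * card (R - X)"
    | v where "v \<in> X" "(2 * r - 1) * card R \<le> 2 * r * (r - 1) * card (nonadj v)"
    | "\<rho>0 \<le> card R" "4 * r * card (R - X) < card R"
      "\<And>v. v \<in> X \<Longrightarrow> 2 * r * (r - 1) * card (nonadj v) \<le> (2 * r - 1) * card R"
    by (meson linorder_not_le nat_le_linear)
  then show ?thesis
  proof cases
    case 1
    then show ?thesis using sum_T_small_R assms by (auto simp: C0_def)
  next
    case 2
    have "(m * \<tau> + 1) * card (verts G) \<le> m * sum T (verts G)"
      by (rule sum_T_many_rich[OF _ _ 2 assms]) (auto simp: X_def)
    then show ?thesis by linarith
  next
    case 3
    then have "(m * \<tau> + 1) * card (verts G) \<le> m * sum T (verts G) + m * (m * \<tau> + 1) * (r * T0)"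
      by (intro sum_T_few_neighbours[of v]) (auto simp: X_def)
    then show ?thesis unfolding C0_def by linarith
  next
    case 4
    have XR: "X \<subseteq> R" by (auto simp: X_def)
    \<comment> \<open>For empty \<open>X\<close> the hypothesis would read
      \<open>4 * r * card R < card R\<close>.\<close>
    have "X \<noteq> {}" using 4(2) r_ge by auto
    then obtain v where v: "v \<in> X" by blast
    have cA: "card (mates v) \<le> r * T0"
      using order_trans[OF card_mates[of v] mult_le_mono2[of "T v" T0 r]] v by (auto simp: X_def)
    have "\<exists>C. C \<subseteq> X \<and> clique G C \<and> card C = Suc k \<and> v \<in> C \<and> C \<inter> mates v = {}" if "Suc k \<le> r" for k
      using that
    proof (induction k)
      case 0
      have "clique G {v}" using v by (auto simp: X_def R_def clique_iff)
      moreover have "v \<notin> mates v" by (simp add: mates_def)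
      ultimately show ?case using v by (intro exI[of _ "{v}"]) auto
    next
      case (Suc k)
      then obtain C where C: "C \<subseteq> X" "clique G C" "card C = Suc k" "v \<in> C" "C \<inter> mates v = {}" by auto
      obtain x where x: "x \<in> X" "x \<notin> C" "x \<notin> mates v" "clique G (insert x C)"
        by (rule grow_clique[OF XR C(1,2) _ finite_mates cA 4(2) _ 4(1)])
          (use Suc.prems C 4(3) in auto)
      have "card (insert x C) = Suc (Suc k)" using x(2) C(3) finite_clique[OF simple C(2)] by simp
      then show ?case using x C by (intro exI[of _ "insert x C"]) auto
    qed
    from this[of "r - 1"] obtain C where C: "C \<subseteq> X" "clique G C" "card C = r" "v \<in> C" "C \<inter> mates v = {}"
      using r_ge by auto
    have "C \<noteq> {v}" using C(3) r_ge by auto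
    then obtain w where w: "w \<in> C" "w \<noteq> v" using C(4) by blast
    then have "w \<in> mates v" unfolding mates_def rcliques_def using C by blast
    then show ?thesis using C(5) w by blast
  qed
qed

end

section \<open>Disjoint unions of cliques\<close>

text \<open>For \<open>m > 0\<close>, vertex \<open>y\<close> belongs to block
  \<open>y div m\<close>, and the \<open>q * m\<close> vertices fill exactly \<open>q\<close>
  blocks.\<close>

definition disjoint_cliques :: "nat \<Rightarrow> nat \<Rightarrow> graph" where
  "disjoint_cliques m q = ({..<q*m}, {e \<in> pairs {..<q*m}. \<forall>x\<in>e. \<forall>y\<in>e. x div m = y div m})"

lemma simple_disjoint_cliques: "simple_graph (disjoint_cliques m q)"
  by (auto simp: simple_graph_def disjoint_cliques_def pairs_def)

lemma disjoint_cliques_edge_iff: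
  "{x, y} \<in> edges (disjoint_cliques m q) \<longleftrightarrow> x < q*m \<and> y < q*m \<and> x \<noteq> y \<and> x div m = y div m"
  by (auto simp: disjoint_cliques_def pairs_def card_2_iff doubleton_eq_iff)

lemma div_fibre_eq:
  fixes m i :: nat
  assumes "0 < m"
  shows "{y. y div m = i} = {i*m..<i*m+m}"
proof -
  have *: "y div m = i \<longleftrightarrow> i*m \<le> y \<and> y < i*m+m" for y
    using dividend_less_div_times[OF assms, of y] div_nat_eqI[of m i y]
    by (auto simp: mult.commute)
  show ?thesis unfolding * by auto
qed

lemma clique_in_fibre:
  assumes "clique (disjoint_cliques m q) S" "x \<in> S"
  shows "S \<subseteq> {y. y div m = x div m}"
proof
  fix y assume "y \<in> S"
  then show "y \<in> {y. y div m = x div m}"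
    using clique_edge[OF assms(1) \<open>y \<in> S\<close> assms(2)] by (cases "y = x") (auto simp: disjoint_cliques_edge_iff)
qed

lemma card_fibre: "0 < m \<Longrightarrow> card {y. y div m = i} = m" for m i :: nat
  by (simp add: div_fibre_eq)

lemma finite_fibre: "0 < m \<Longrightarrow> finite {y. y div m = i}" for m i :: nat
  by (simp add: div_fibre_eq)

lemma clique_fibre:
  assumes "0 < m" "i < q"
  shows "clique (disjoint_cliques m q) {y. y div m = i}"
proof -
  have "y < q * m" if "y div m = i" for y
    using assms that div_less_iff_less_mult[of m y q] by simp
  then show ?thesis unfolding clique_iff disjoint_cliques_edge_iff
    by (auto simp: disjoint_cliques_def)
qed

text \<open>A block has only \<open>m\<close> vertices, while a copy of any forbidden graph would
  force more than \<open>m\<close> into one block. An added edge joins two blocks and completes a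
  dumbbell.\<close>

lemma saturated_disjoint_cliques:
  assumes "0 < r" "r \<le> m"
  shows "saturated (forbidden_family r m) (disjoint_cliques m q)" (is "saturated _ ?G")
proof -
  have m: "0 < m" using assms by simp
  note sG = simple_disjoint_cliques[of m q]
  have le: "card B \<le> m" if "B \<subseteq> {y. y div m = i}" for B i
    using card_mono[OF finite_fibre[OF m] that] card_fibre[OF m] by simp
  have "copies (dumbbell m) ?G = {}"
  proof (rule ccontr)
    assume "copies (dumbbell m) ?G \<noteq> {}"
    then obtain P Q x y where PQ: "clique ?G P" "clique ?G Q" "card P = m" "card Q = m" "P \<inter> Q = {}"
      "x \<in> P" "y \<in> Q" "{x, y} \<in> edges ?G"
      using dumbbell_embeds_iff[OF sG m] by blast
    have "y div m = x div m" using PQ(8) disjoint_cliques_edge_iff by simp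
    then have "P \<union> Q \<subseteq> {z. z div m = x div m}"
      using clique_in_fibre[OF PQ(1,6)] clique_in_fibre[OF PQ(2,7)] by auto
    from le[OF this] have "card (P \<union> Q) \<le> m" .
    moreover have "card (P \<union> Q) = m + m"
      using PQ finite_clique[OF sG] by (simp add: card_Un_disjoint)
    ultimately show False using m by simp
  qed
  moreover have "copies (clique_apex m r) ?G = {}"
  proof (rule ccontr)
    assume "copies (clique_apex m r) ?G \<noteq> {}"
    then obtain P z W where PW: "clique ?G P" "card P = m" "z \<notin> P" "W \<subseteq> P" "card W = r"
       "\<forall>w\<in>W. {z, w} \<in> edges ?G"
      using clique_apex_embeds_iff[OF sG assms(2) m] by blast
    then obtain w where w: "w \<in> W" using assms(1) by fastforce
    then have "z div m = w div m" using PW(6) disjoint_cliques_edge_iff by simp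
    then have "insert z P \<subseteq> {y. y div m = w div m}"
      using clique_in_fibre[OF PW(1), of w] w PW(4) by auto
    from le[OF this] show False using PW finite_clique[OF sG PW(1)] by simp
  qed
  moreover have "copies (glued_cliques m r) ?G = {}"
  proof (rule ccontr)
    assume "copies (glued_cliques m r) ?G \<noteq> {}"
    then obtain P Q x where PQ: "clique ?G P" "clique ?G Q" "card P = m" "card Q = m - r + 2"
       "P \<inter> Q = {x}"
      using glued_cliques_embeds_iff[OF sG assms(2) m] by blast
    have "x \<in> P" "x \<in> Q" using PQ(5) by auto
    then have "P \<union> Q \<subseteq> {z. z div m = x div m}"
      using clique_in_fibre[OF PQ(1)] clique_in_fibre[OF PQ(2)] by auto
    from le[OF this] have "card (P \<union> Q) \<le> m" .
    \<comment> \<open>The union would have \<open>2 * m - r + 1\<close> vertices, more than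
      \<open>m\<close> because \<open>r \<le> m\<close>.\<close>
    moreover have "card (P \<union> Q) + 1 = m + (m - r + 2)"
      using card_Un_Int[of P Q] PQ finite_clique[OF sG] by simp
    ultimately show False by simp
  qed
  moreover have "copies (dumbbell m) (add_edge ?G u v) \<noteq> {}"
    if uv: "u \<in> verts ?G" "v \<in> verts ?G" "u \<noteq> v" "{u, v} \<notin> edges ?G" for u v
  proof -
    let ?H = "add_edge ?G u v"
    have lt: "u < q*m" "v < q*m" using uv by (auto simp: disjoint_cliques_def)
    then have ne: "u div m \<noteq> v div m" using uv disjoint_cliques_edge_iff by simp
    have "u div m < q" "v div m < q" using lt m by (simp_all add: div_less_iff_less_mult)
    then have "clique ?G {y. y div m = u div m}" "clique ?G {y. y div m = v div m}"
      using clique_fibre[OF m] by blast+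
    then have "clique ?H {y. y div m = u div m}" "clique ?H {y. y div m = v div m}"
      by (auto simp: clique_def add_edge_def)
    moreover have "{y. y div m = u div m} \<inter> {y. y div m = v div m} = {}" using ne by auto
    moreover have "{u, v} \<in> edges ?H" by (simp add: add_edge_def)
    ultimately show ?thesis
      using dumbbell_embeds_iff[OF simple_graph_add_edge[OF sG uv(1,2,3)] m] card_fibre[OF m] by blast
  qed
  ultimately show ?thesis unfolding saturated_def forbidden_family_def by auto
qed

lemma cliques_in_disjoint_cliques:
  assumes "0 < r" "0 < m"
  shows "card {S. clique (disjoint_cliques m q) S \<and> card S = r} \<le> q * (m choose r)"
proof -
  let ?B = "\<lambda>i. {S. S \<subseteq> {y. y div m = i} \<and> card S = r}"
  have fin: "finite (?B i)" for i
    by (rule finite_subset[of _ "Pow {y. y div m = i}"]) (blast, simp add: finite_fibre[OF assms(2)])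
  have "{S. clique (disjoint_cliques m q) S \<and> card S = r} \<subseteq> (\<Union>i<q. ?B i)"
  proof
    fix S assume "S \<in> {S. clique (disjoint_cliques m q) S \<and> card S = r}"
    then have S: "clique (disjoint_cliques m q) S" "card S = r" by auto
    then obtain x where x: "x \<in> S" using assms(1) by fastforce
    have "x < q*m" using S(1) x by (auto simp: clique_def disjoint_cliques_def)
    then have "x div m < q" using assms(2) by (simp add: div_less_iff_less_mult)
    then show "S \<in> (\<Union>i<q. ?B i)" using clique_in_fibre[OF S(1) x] S(2) by blast
  qed
  then have "card {S. clique (disjoint_cliques m q) S \<and> card S = r} \<le> card (\<Union>i<q. ?B i)"
    by (rule card_mono[rotated]) (intro finite_UN_I fin finite_lessThan)
  also have "\<dots> \<le> (\<Sum>i<q. card (?B i))" by (rule card_UN_le) simp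
  also have "\<dots> = (\<Sum>i<q. m choose r)"
    by (simp only: n_subsets[OF finite_fibre[OF assms(2)]] card_fibre[OF assms(2)])
  finally show ?thesis by simp
qed

lemma sat_upper_bound:
  assumes "0 < r" "r \<le> m"
  shows "sat (q * m) (complete_graph r) (forbidden_family r m) \<le> q * (m choose r)"
proof -
  let ?G = "disjoint_cliques m q"
  have "card (verts ?G) = q * m" by (simp add: disjoint_cliques_def)
  then have "sat (q * m) (complete_graph r) (forbidden_family r m) \<le> card (copies (complete_graph r) ?G)"
    unfolding sat_def using simple_disjoint_cliques saturated_disjoint_cliques[OF assms]
    by (intro cInf_lower) (blast, simp)
  also have "\<dots> \<le> q * (m choose r)"
    using card_copies_complete_graph[OF simple_disjoint_cliques] cliques_in_disjoint_cliques assms by simp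
  finally show ?thesis .
qed

section \<open>Non-convergence of the ratio\<close>

text \<open>An edge-maximal graph without forbidden copies is saturated, and the edgeless graph is a
  candidate. Thus the infimum in \<open>sat\<close> is attained, and the default
  \<open>Inf {} = 0\<close> cannot spoil the lower bound.\<close>

lemma saturated_graph_exists:
  assumes "\<And>H. H \<in> \<F> \<Longrightarrow> simple_graph H \<and> edges H \<noteq> {}"
  shows "\<exists>G. simple_graph G \<and> card (verts G) = n \<and> saturated \<F> G"
proof -
  define \<E> where "\<E> = {E. E \<subseteq> pairs {..<n} \<and> (\<forall>H\<in>\<F>. copies H ({..<n}, E) = {})}"
  have "finite (pairs {..<n})"
    by (rule finite_subset[of _ "Pow {..<n}"]) (auto simp: pairs_def)
  then have "finite (Pow (pairs {..<n}))" by simp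
  then have "finite \<E>" unfolding \<E>_def by (rule finite_subset[rotated]) blast
  moreover have "copies H ({..<n}, {}) = {}" if "H \<in> \<F>" for H
    using copies_nonempty_iff[of H "({..<n}, {})"] assms[OF that] by (auto simp: embeds_def)
  then have "{} \<in> \<E>" by (simp add: \<E>_def)
  ultimately obtain E where E: "E \<in> \<E>" "\<And>E'. E' \<in> \<E> \<Longrightarrow> E \<subseteq> E' \<Longrightarrow> E = E'"
    using finite_has_maximal[of \<E>] by blast
  let ?G = "({..<n}, E)"
  have "simple_graph ?G" using E(1) by (auto simp: \<E>_def simple_graph_def pairs_def)
  moreover have "saturated \<F> ?G"
    unfolding saturated_def
  proof (intro conjI ballI impI)
    show "copies H ?G = {}" if "H \<in> \<F>" for H using E(1) that by (simp add: \<E>_def)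
  next
    fix u v assume uv: "u \<in> verts ?G" "v \<in> verts ?G" "u \<noteq> v \<and> {u, v} \<notin> edges ?G"
    then have "insert {u, v} E \<notin> \<E>" using E(2)[of "insert {u, v} E"] by auto
    moreover have "insert {u, v} E \<subseteq> pairs {..<n}"
      using E(1) uv by (auto simp: \<E>_def intro: doubleton_in_pairs)
    ultimately show "\<exists>H\<in>\<F>. copies H (add_edge ?G u v) \<noteq> {}"
      by (auto simp: \<E>_def add_edge_def)
  qed
  ultimately show ?thesis by (intro exI[of _ ?G]) auto
qed

lemma forbidden_family_simple:
  assumes "2 \<le> m" "r \<le> m" "H \<in> forbidden_family r m"
  shows "simple_graph H \<and> edges H \<noteq> {}"
proof -
  have "{0, 1} \<in> pairs {..<m}" using assms(1) by (intro doubleton_in_pairs) auto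
  then show ?thesis
    using assms simple_graph_forbidden[of m]
    by (auto simp: forbidden_family_def dumbbell_def clique_apex_def glued_cliques_def)
qed

lemma sat_lower_bound:
  assumes "3 \<le> r" "4 * r ^ 3 \<le> m"
  shows "\<exists>C. \<forall>n. \<not> m dvd n \<longrightarrow>
    (m * ((m - 1) choose (r - 1)) + 1) * n \<le> m * r * sat n (complete_graph r) (forbidden_family r m) + C"
proof (intro exI allI impI)
  fix n assume n: "\<not> m dvd n"
  have rm: "r \<le> m" using self_le_power[of r 3] assms by linarith
  have "\<exists>G. simple_graph G \<and> card (verts G) = n \<and> saturated (forbidden_family r m) G"
    using forbidden_family_simple[of m r] rm assms by (intro saturated_graph_exists) auto
  then have "sat n (complete_graph r) (forbidden_family r m) \<in>
     {card (copies (complete_graph r) G) | G.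
       simple_graph G \<and> card (verts G) = n \<and> saturated (forbidden_family r m) G}"
    unfolding sat_def by (intro Inf_nat_def1) auto
  then obtain G where G: "simple_graph G" "card (verts G) = n" "saturated (forbidden_family r m) G"
    "sat n (complete_graph r) (forbidden_family r m) = card (copies (complete_graph r) G)" by auto
  interpret saturated_graph G r m by unfold_locales (use G assms in auto)
  \<comment> \<open>An empty \<open>R\<close> would leave \<open>n = m * card K\<close>.\<close>
  have "R \<noteq> {}" using card_verts G(2) n by auto
  \<comment> \<open>This fixes the constant left open by \<open>exI\<close>; \<open>C0\<close>
    depends on \<open>r\<close> and \<open>m\<close> alone, hence is uniform in
    \<open>n\<close>.\<close>
  from sum_T_lower_bound[OF this]
  show "(m * ((m - 1) choose (r - 1)) + 1) * n \<le>
      m * r * sat n (complete_graph r) (forbidden_family r m) + saturated_graph.C0 r m"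
    using sum_T_verts G(2,4) card_copies_complete_graph[OF G(1)]
    by (simp add: \<tau>_def rcliques_def mult.assoc)
qed

text \<open>Along multiples of \<open>m\<close>, the ratio times \<open>m * r\<close> is at most
  \<open>m * t\<close>; along \<open>n = q * m + 1\<close> it is at least \<open>m * t + 1\<close>
  up to a term of order \<open>1 / n\<close>. No limit satisfies both.\<close>

lemma sat_ratio_diverges:
  assumes "3 \<le> r" "4 * r ^ 3 \<le> m"
  shows "\<not> (\<exists>L::real. (\<lambda>n. real (sat n (complete_graph r) (forbidden_family r m)) / real n) \<longlonglongrightarrow> L)"
proof
  define s where "s n = sat n (complete_graph r) (forbidden_family r m)" for n
  define t where "t = (m - 1) choose (r - 1)"
  assume "\<exists>L::real. (\<lambda>n. real (sat n (complete_graph r) (forbidden_family r m)) / real n) \<longlonglongrightarrow> L"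
  then obtain L where L: "(\<lambda>n. real (s n) / real n) \<longlonglongrightarrow> L" unfolding s_def by blast
  obtain C where C: "\<And>n. \<not> m dvd n \<Longrightarrow> (m * t + 1) * n \<le> m * r * s n + C"
    using sat_lower_bound[OF assms] unfolding s_def t_def by blast
  have rm: "r \<le> m" using self_le_power[of r 3] assms by linarith
  then have m: "1 < m" using assms by linarith
  \<comment> \<open>Both sides count the incidences of vertices and \<open>r\<close>-subsets in a
    \<open>K_m\<close>.\<close>
  have rt: "r * (m choose r) = m * t"
    using binomial_absorption[of "r - 1" m] assms by (simp add: t_def)
  have lim: "(\<lambda>q. real (s (f q)) / real (f q)) \<longlonglongrightarrow> L" if "strict_mono f" for f
    using LIMSEQ_subseq_LIMSEQ[OF L that] by (simp add: o_def)
  \<comment> \<open>\<open>Suc q\<close> starts the subsequence at \<open>m\<close>, so that the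
    denominators are positive.\<close>
  have "(\<lambda>q. real (s (Suc q * m)) / real (Suc q * m)) \<longlonglongrightarrow> L"
    using m by (intro lim strict_monoI) simp
  then have "(\<lambda>q. real (m * r) * (real (s (Suc q * m)) / real (Suc q * m))) \<longlonglongrightarrow> real (m * r) * L"
    by (intro tendsto_mult tendsto_const)
  moreover have "real (m * r) * (real (s (Suc q * m)) / real (Suc q * m)) \<le> real (m * t)" for q
  proof -
    have "s (Suc q * m) \<le> Suc q * (m choose r)"
      unfolding s_def using assms rm by (intro sat_upper_bound) auto
    then have "m * r * s (Suc q * m) \<le> m * r * (Suc q * (m choose r))" by (rule mult_left_mono) simp
    also have "\<dots> = m * t * (Suc q * m)" using rt by (metis mult.assoc mult.commute mult.left_commute)
    finally have "real (m * r * s (Suc q * m)) \<le> real (m * t * (Suc q * m))" by (rule of_nat_mono)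
    moreover have "0 < real (Suc q * m)" unfolding of_nat_0_less_iff using m by simp
    ultimately show ?thesis by (simp only: of_nat_mult times_divide_eq_right pos_divide_le_eq)
  qed
  ultimately have up: "real (m * r) * L \<le> real (m * t)"
    by (intro LIMSEQ_le_const2[where a = "real (m * t)"]) auto
  \<comment> \<open>The second subsequence has residue 1 modulo \<open>m > 1\<close>, so the lower
    bound applies to every term.\<close>
  have "(\<lambda>q. real (s (Suc (q * m))) / real (Suc (q * m))) \<longlonglongrightarrow> L"
    using m by (intro lim strict_monoI) simp
  then have "(\<lambda>q. real (m * r) * (real (s (Suc (q * m))) / real (Suc (q * m)))) \<longlonglongrightarrow> real (m * r) * L"
    by (intro tendsto_mult tendsto_const)
  moreover have "(\<lambda>q. real C / real (Suc (q * m))) \<longlonglongrightarrow> 0"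
  proof -
    have "(\<lambda>n. real C / real n) \<longlonglongrightarrow> 0" by (rule lim_const_over_n)
    moreover have "strict_mono (\<lambda>q. Suc (q * m))" using m by (intro strict_monoI) simp
    ultimately show ?thesis using LIMSEQ_subseq_LIMSEQ by (fastforce simp: o_def)
  qed
  ultimately have "(\<lambda>q. real (m * r) * (real (s (Suc (q * m))) / real (Suc (q * m)))
      + real C / real (Suc (q * m))) \<longlonglongrightarrow> real (m * r) * L + 0"
    by (rule tendsto_add)
  moreover have "real (m * t + 1) \<le> real (m * r) * (real (s (Suc (q * m))) / real (Suc (q * m)))
      + real C / real (Suc (q * m))" for q
  proof -
    have "\<not> m dvd Suc (q * m)"
    proof
      assume "m dvd Suc (q * m)"
      then have "m dvd Suc (q * m) - q * m" by (intro dvd_diff_nat) auto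
      then show False using m by simp
    qed
    from C[OF this] have "real ((m * t + 1) * Suc (q * m)) \<le> real (m * r * s (Suc (q * m)) + C)"
      by (rule of_nat_mono)
    moreover have "0 < real (Suc (q * m))" unfolding of_nat_0_less_iff by simp
    ultimately show ?thesis
      by (simp only: of_nat_mult of_nat_add times_divide_eq_right add_divide_distrib[symmetric]
          pos_le_divide_eq)
  qed
  ultimately have "real (m * t + 1) \<le> real (m * r) * L + 0"
    by (intro LIMSEQ_le_const[where a = "real (m * t + 1)"]) auto
  with up show False by simp
qed

section \<open>Vertex counts as invariants of the forbidden graphs and families\<close>

lemma graph_iso_card_verts: "graph_iso G H \<Longrightarrow> card (verts G) = card (verts H)"
  by (auto simp: graph_iso_def dest: bij_betw_same_card)

lemma graph_iso_refl: "graph_iso G G"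
  unfolding graph_iso_def by (rule exI[of _ id]) simp

lemma card_verts_iso_class:
  assumes "simple_graph G"
  shows "(\<lambda>H. card (verts H)) ` iso_class G = {card (verts G)}"
  using assms graph_iso_card_verts[of G] graph_iso_refl[of G]
  by (force simp: iso_class_def)

lemma card_verts_forbidden:
  "card (verts (dumbbell m)) = 2 * m" "card (verts (clique_apex m r)) = m + 1"
  "card (verts (glued_cliques m r)) = 2 * m - r + 1"
  by (simp_all add: dumbbell_def clique_apex_def glued_cliques_def)

text \<open>For \<open>2 \<le> r < m\<close> the three vertex counts \<open>2 * m\<close>,
  \<open>m + 1\<close> and \<open>2 * m - r + 1\<close> are distinct.\<close>

lemma graph_family_forbidden:
  assumes "2 \<le> r" "r < m"
  shows "graph_family (forbidden_family r m)" "card (forbidden_family r m) = 3"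
proof -
  have simple: "simple_graph H" if "H \<in> forbidden_family r m" for H
    using forbidden_family_simple[OF _ _ that] assms by simp
  have inj: "inj_on (\<lambda>H. card (verts H)) (forbidden_family r m)"
    using assms by (auto simp: forbidden_family_def inj_on_def card_verts_forbidden)
  have "inj_on iso_class (forbidden_family r m)"
  proof (rule inj_onI)
    fix H H' assume *: "H \<in> forbidden_family r m" "H' \<in> forbidden_family r m" "iso_class H = iso_class H'"
    then have "card (verts H) = card (verts H')"
      using card_verts_iso_class[OF simple] by (metis singleton_inject)
    then show "H = H'" using inj * by (auto dest: inj_onD)
  qed
  then show "graph_family (forbidden_family r m)" using simple by (simp add: graph_family_def)
  have "(\<lambda>H. card (verts H)) ` forbidden_family r m = {2 * m, m + 1, 2 * m - r + 1}"
    by (simp add: forbidden_family_def card_verts_forbidden)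
  moreover have "card {2 * m, m + 1, 2 * m - r + 1} = 3" using assms by auto
  ultimately show "card (forbidden_family r m) = 3" using card_image[OF inj] by simp
qed

lemma card_verts_family_class:
  assumes "2 \<le> r" "r < m"
  shows "(\<lambda>H. card (verts H)) ` \<Union>(family_class (forbidden_family r m)) = {2 * m, m + 1, 2 * m - r + 1}"
proof -
  have "(\<lambda>H. card (verts H)) ` \<Union>(family_class (forbidden_family r m))
      = (\<Union>G\<in>forbidden_family r m. (\<lambda>H. card (verts H)) ` iso_class G)"
    by (auto simp: family_class_def)
  also have "\<dots> = (\<Union>G\<in>forbidden_family r m. {card (verts G)})"
    using forbidden_family_simple[of m r] assms card_verts_iso_class by (intro SUP_cong) auto
  also have "\<dots> = {2 * m, m + 1, 2 * m - r + 1}"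
    by (auto simp: forbidden_family_def card_verts_forbidden)
  finally show ?thesis .
qed

text \<open>The largest vertex count in the family is \<open>2 * m\<close>, which recovers
  \<open>m\<close>.\<close>

lemma inj_on_forbidden_family:
  assumes "2 \<le> r"
  shows "inj_on (\<lambda>m. family_class (forbidden_family r m)) {r<..}"
proof (rule inj_onI)
  fix m m' assume *: "m \<in> {r<..}" "m' \<in> {r<..}"
    "family_class (forbidden_family r m) = family_class (forbidden_family r m')"
  then have "{2 * m, m + 1, 2 * m - r + 1} = {2 * m', m' + 1, 2 * m' - r + 1}"
    using card_verts_family_class[OF assms, of m] card_verts_family_class[OF assms, of m'] by simp
  then have "2 * m \<in> {2 * m', m' + 1, 2 * m' - r + 1}" "2 * m' \<in> {2 * m, m + 1, 2 * m - r + 1}"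
    by blast+
  then show "m = m'" using * assms by auto
qed

theorem theorem1p9:
  fixes r :: nat
  assumes "r \<ge> 3"
  shows "infinite (family_class `
    {\<F>. graph_family \<F> \<and> card \<F> = 3 \<and>
         \<not> (\<exists>L::real. (\<lambda>n. real (sat n (complete_graph r) \<F>) / real n) \<longlonglongrightarrow> L)})"
proof -
  let ?S = "{\<F>. graph_family \<F> \<and> card \<F> = 3 \<and>
    \<not> (\<exists>L::real. (\<lambda>n. real (sat n (complete_graph r) \<F>) / real n) \<longlonglongrightarrow> L)}"
  \<comment> \<open>The threshold is the one of \<open>binomial_ratio_bound\<close>; every
    \<open>m\<close> beyond it yields a family.\<close>
  let ?M = "{4 * r ^ 3..}"
  have lt: "r < 4 * r ^ 3" using self_le_power[of r 3] assms by linarith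
  then have "?M \<subseteq> {r<..}" by auto
  then have "inj_on (\<lambda>m. family_class (forbidden_family r m)) ?M"
    using inj_on_forbidden_family[of r] assms inj_on_subset by fastforce
  then have "infinite ((\<lambda>m. family_class (forbidden_family r m)) ` ?M)"
    using infinite_Ici finite_imageD by blast
  moreover have "forbidden_family r m \<in> ?S" if "m \<in> ?M" for m
    using that lt assms graph_family_forbidden[of r m] sat_ratio_diverges[of r m] by simp
  then have "(\<lambda>m. family_class (forbidden_family r m)) ` ?M \<subseteq> family_class ` ?S" by blast
  ultimately show ?thesis by (rule infinite_super[rotated])
qed

end
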